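(* There is a constant $c>0$ such that for all sufficiently large integers $n$, $$r_4(5,4;n)\ \ge\ 2^{\,n^{c\log\log n}}.$$
   Context: For $k\ge 2$, a $k$-graph is a $k$-uniform hypergraph, and $K^{(k)}_n$ denotes the complete $k$-graph on an $n$-element vertex set (its edges are all $k$-element subsets). For integers $2\le k<n$ and $2\le t\le k+1$, the Erdős–Hajnal function $r_k(k+1,t;n)$ is the minimum $N$ such that for every red/blue coloring of the edges of $K^{(k)}_N$, either there are $k+1$ vertices such that at least $t$ of the $k+1$ edges contained in them are red, or there is a blue copy of $K^{(k)}_n$ (i.e. $n$ vertices all of whose $k$-subsets are blue). In particular $r_4(5,4;n)$ is the case $k=4$, $t=4$. All logarithms are to base 2. *)

theory Defs
  imports Complex_Main "HOL-Library.Ramsey"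
begin

text \<open>
  The edges of the complete k-graph on the vertex set \<open>V\<close> are the elements of \<open>nsets V k\<close>.
  A red/blue colouring of its edges is given by its set \<open>R\<close> of red edges; the remaining edges
  are blue.
\<close>

definition EH_arrows :: "nat \<Rightarrow> nat \<Rightarrow> nat \<Rightarrow> nat \<Rightarrow> nat \<Rightarrow> bool" where
  "EH_arrows k s t n N \<longleftrightarrow>
     (\<forall>R \<subseteq> nsets {..<N} k.
        (\<exists>S \<in> nsets {..<N} s. card (nsets S k \<inter> R) \<ge> t) \<or>
        (\<exists>T \<in> nsets {..<N} n. nsets T k \<inter> R = {}))"

text \<open>
  The Erdos-Hajnal function $r_k(s,t;n)$. The minimum is over a nonempty set whenever
  \<open>t \<le> s choose k\<close>, see \<open>ex_EH_arrows\<close> below.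
\<close>

definition EH_number :: "nat \<Rightarrow> nat \<Rightarrow> nat \<Rightarrow> nat \<Rightarrow> nat" where
  "EH_number k s t n = (LEAST N. EH_arrows k s t n N)"

lemma ex_EH_arrows:
  assumes "t \<le> s choose k"
  shows "\<exists>N. EH_arrows k s t n N"
proof -
  obtain N :: nat where N: "partn_lst {..<N} [s, n] k"
    using ramsey2_full by blast
  have "EH_arrows k s t n N"
    unfolding EH_arrows_def
  proof (intro allI impI)
    fix R :: "nat set set"
    define f :: "nat set \<Rightarrow> nat" where "f = (\<lambda>e. if e \<in> R then 0 else 1)"
    have "f \<in> nsets {..<N} k \<rightarrow> {..<2}"
      by (auto simp: f_def)
    then obtain i H where i: "i < 2" and H: "H \<in> nsets {..<N} ([s, n] ! i)"
      and mono: "f ` nsets H k \<subseteq> {i}"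
      using partn_lstE[OF N] by (metis One_nat_def Suc_1 length_Cons list.size(3))
    show "(\<exists>S \<in> nsets {..<N} s. card (nsets S k \<inter> R) \<ge> t) \<or>
          (\<exists>T \<in> nsets {..<N} n. nsets T k \<inter> R = {})"
    proof (cases "i = 0")
      case True
      then have "nsets H k \<inter> R = nsets H k"
        using mono by (auto simp: f_def split: if_splits)
      moreover have "card H = s"
        using H True by (simp add: nsets_def)
      ultimately have "card (nsets H k \<inter> R) \<ge> t"
        using assms by simp
      then show ?thesis
        using H True by auto
    next
      case False
      then have "i = 1" using i by simp
      then have "nsets H k \<inter> R = {}"
        using mono by (auto simp: f_def split: if_splits)
      then show ?thesis
        using H \<open>i = 1\<close> by auto
    qed
  qed
  then show ?thesis ..
qed

end

theory Submission
  imports Defs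
begin

text \<open>
  The bound comes from a 3-uniform hypergraph \<open>H\<close> on \<open>M\<close> vertices in which every four vertices
  span at most two edges, while every set of \<open>C log M / log log M\<close> vertices contains an edge.

  Such an \<open>H\<close> is stepped up to 4-edges as follows. The vertices are the leaves of the complete
  binary tree of height \<open>M\<close>, and \<open>\<delta>(u, v)\<close> is the height of the lowest common ancestor. For leaves
  \<open>v\<^sub>1 < v\<^sub>2 < v\<^sub>3 < v\<^sub>4\<close> put \<open>\<delta>\<^sub>i = \<delta>(v\<^sub>i, v\<^sub>i\<^sub>+\<^sub>1)\<close>; the 4-set is red if \<open>\<delta>\<^sub>1, \<delta>\<^sub>2, \<delta>\<^sub>3\<close> is monotone and an
  edge of \<open>H\<close>. Five leaves with four red subsets would force \<open>\<delta>\<^sub>1, \<dots>, \<delta>\<^sub>4\<close> to be monotone and three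
  edges of \<open>H\<close> among four vertices (\<open>red4_five\<close>). On the other hand, \<open>n\<close> leaves contain a comb, that
  is, a sequence with monotone \<open>\<delta>\<close>, with about \<open>(log n) / 2\<close> levels (\<open>comb_exists\<close>). If there is no
  red 4-set among them, the levels of the comb are independent in \<open>H\<close>, hence
  \<open>log n \<le> 2 C log M / log log M\<close>. So \<open>M\<close> can be as large as
  \<open>n ^ (c log log n)\<close>, and the number of leaves is \<open>2 ^ M\<close>.

  The hypergraph \<open>H\<close> consists of the triples that are cyclic in more than two thirds of
  \<open>d\<close> random tournaments. Four vertices of a tournament span at most two cyclic triangles, so by
  averaging over the \<open>d\<close> tournaments three triples on four vertices cannot all be edges
  (\<open>cyclic_count_four_vertices\<close>). Here \<open>d\<close> is about half the logarithm of the size \<open>k\<close> of the sets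
  that are to be hit, so that a pair has \<open>D = 2 ^ d\<close> colours, a power of \<open>k\<close>. For the union bound
  over all \<open>k\<close>-sets each of the \<open>k\<^sup>2\<close> pairs has to contribute a factor \<open>D ^ (-c)\<close> to the
  probability of independence; a constant factor per pair, which is what one tournament yields, would
  lose the factor \<open>log log M\<close>.

  This factor comes from concentration of measure: if \<open>X, Y, Z\<close> are sets of colours, each of density
  more than \<open>\<theta> = D ^ (-1/84)\<close>, then some \<open>x \<in> X\<close>, \<open>y \<in> Y\<close>, \<open>z \<in> Z\<close> on the three pairs make a triple an
  edge (\<open>cyclic_count_hits_boxes\<close>). Split a \<open>k\<close>-set into thirds \<open>A < B < B'\<close> and reveal the colours
  between \<open>u \<in> A\<close> and \<open>B \<union> B'\<close> for one \<open>u\<close> after another. Every pair in \<open>B \<times> B'\<close> keeps a set of colours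
  that do not yet close an edge. As long as half of these sets have density above \<open>\<theta>\<close>, the
  colours of \<open>u\<close> remove elements from many of them, except with probability about \<open>\<theta> ^ (c k)\<close>
  (\<open>lazy_rows_count\<close>). There is not enough to remove for this to go on, so in the end half of
  the sets have density at most \<open>\<theta>\<close>, up to an event of probability \<open>\<theta> ^ (c k\<^sup>2)\<close>; then the colours of
  the pairs in \<open>B \<times> B'\<close> avoid all edges only with probability \<open>\<theta> ^ (c k\<^sup>2)\<close> as well
  (\<open>tripartite_independent_count\<close>). All probabilities are expressed by counting colourings.
\<close>

section \<open>Concentration of measure in the cube\<close>

definition cube :: "nat \<Rightarrow> bool list set" where
  "cube d = {xs. length xs = d}"

definition hdist :: "nat \<Rightarrow> bool list \<Rightarrow> bool list \<Rightarrow> nat" where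
  "hdist d x y = (\<Sum>i<d. of_bool (x ! i \<noteq> y ! i))"

lemma finite_cube: "finite (cube d)"
  using finite_lists_length_eq[of "UNIV :: bool set" d] by (simp add: cube_def)

lemma card_cube: "card (cube d) = 2 ^ d"
  using card_lists_length_eq[of "UNIV :: bool set" d] by (simp add: cube_def)

lemma hdist_Cons: "hdist (Suc d) (a # x) (b # y) = of_bool (a \<noteq> b) + hdist d x y"
  unfolding hdist_def by (subst sum.lessThan_Suc_shift) simp

lemma cube_Suc: "cube (Suc d) = (#) True ` cube d \<union> (#) False ` cube d"
proof -
  have "x \<in> (#) True ` cube d \<union> (#) False ` cube d" if "length x = Suc d" for x
    using that by (cases x; cases "hd x") (auto simp: cube_def)
  then show ?thesis by (auto simp: cube_def)
qed

lemma sum_cube_Suc: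
  "(\<Sum>x\<in>cube (Suc d). F x) = (\<Sum>x\<in>cube d. F (True # x)) + (\<Sum>x\<in>cube d. F (False # x))"
proof -
  have "(\<Sum>x\<in>cube (Suc d). F x) = sum F ((#) True ` cube d) + sum F ((#) False ` cube d)"
    unfolding cube_Suc by (rule sum.union_disjoint) (auto simp: finite_cube)
  also have "\<dots> = (\<Sum>x\<in>cube d. F (True # x)) + (\<Sum>x\<in>cube d. F (False # x))"
    by (simp add: sum.reindex)
  finally show ?thesis .
qed

text \<open>
  The induction step for the exponential moment: \<open>a\<close> and \<open>b\<close> are the sizes of the two slices of a set,
  and \<open>S\<close> and \<open>T\<close> the moments over the two halves of the cube. The smaller slice is useless for
  bounding \<open>T\<close> when \<open>b < a / s\<close>; then one passes to the larger slice at the price of a factor \<open>s\<close>.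
\<close>
lemma slice_inequality:
  fixes s a b S T :: real
  assumes "s \<ge> 1" "a > 0" "0 \<le> b" "b \<le> a" "K \<ge> 0"
    and S: "S * a \<le> K" and T1: "T * b \<le> K" and T2: "T * a \<le> s * K"
  shows "(S + T) * (a + b) \<le> (2 + s + 1/s) * K"
proof -
  show ?thesis
  proof (cases "a \<le> s * b")
    case False
    have "(S + T) * (a + b) \<le> ((1 + s) * K / a) * (a + b)"
    proof (rule mult_right_mono)
      have "(S + T) * a \<le> (1 + s) * K" using S T2 by (simp add: algebra_simps)
      then show "S + T \<le> (1 + s) * K / a" using assms by (simp add: field_simps)
    qed (use assms in auto)
    also have "\<dots> = (1 + s) * K * (1 + b / a)" using assms by (simp add: field_simps)
    also have "\<dots> \<le> (1 + s) * K * (1 + 1 / s)"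
      by (rule mult_left_mono) (use assms False in \<open>auto simp: field_simps\<close>)
    also have "\<dots> = (2 + s + 1/s) * K" using assms by (simp add: field_simps)
    finally show ?thesis .
  next
    case True
    then have b: "b > 0" using assms by (smt (verit) mult_nonneg_nonpos)
    have "(S + T) * (a + b) \<le> (K / a + K / b) * (a + b)"
      by (intro mult_right_mono add_mono) (use S T1 b assms in \<open>auto simp: field_simps\<close>)
    also have "\<dots> = (2 + (a / b + b / a)) * K" using assms b by (simp add: field_simps)
    also have "\<dots> \<le> (2 + (s + 1/s)) * K"
    proof (intro mult_right_mono add_left_mono)
      define r where "r = a / b"
      have r: "r \<ge> 1" "r \<le> s" using True b assms by (auto simp: r_def field_simps)
      have "s + 1/s - (r + 1/r) = (s - r) * (1 - 1 / (s * r))"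
        using r by (simp add: field_simps)
      moreover have "1 / (s * r) \<le> 1"
      proof -
        have "1 \<le> s * r" using r mult_mono[of 1 s 1 r] by simp
        then show ?thesis by simp
      qed
      ultimately have "s + 1/s - (r + 1/r) \<ge> 0" using r by simp
      then show "a / b + b / a \<le> s + 1/s" by (simp add: r_def)
    qed (use assms in auto)
    finally show ?thesis by (simp add: add.assoc)
  qed
qed

text \<open>
  Talagrand's argument: a point with first coordinate \<open>b\<close> is close to \<open>A\<close> if it is close to the slice
  of \<open>A\<close> at \<open>b\<close>, or, up to one more step, to the slice at \<open>\<not> b\<close>. Any minorant \<open>g\<close> of the distance to
  \<open>A\<close> is allowed, which lets the induction pass to slices without having to speak of the distance to a
  possibly empty slice.
\<close>
lemma hamming_exponential_moment:
  fixes s :: real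
  assumes s: "s \<ge> 1" and "A \<subseteq> cube d" "A \<noteq> {}"
    and "\<And>x a. x \<in> cube d \<Longrightarrow> a \<in> A \<Longrightarrow> g x \<le> hdist d x a"
  shows "(\<Sum>x\<in>cube d. s ^ g x) * card A \<le> (2 + s + 1/s) ^ d"
  using assms(2-)
proof (induction d arbitrary: A g)
  case 0
  have c: "cube 0 = {[]}" by (auto simp: cube_def)
  then have A: "A = {[]}" using 0 by auto
  have "g [] = 0" using 0(3)[of "[]" "[]"] A c by (simp add: hdist_def)
  then show ?case using A c by simp
next
  case (Suc d)
  define K where "K = (2 + s + 1/s) ^ d"
  define Sl where "Sl b = {x. b # x \<in> A}" for b
  define S where "S b = (\<Sum>x\<in>cube d. s ^ g (b # x))" for b
  have K: "K \<ge> 0" using s by (simp add: K_def)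
  have Sl: "Sl b \<subseteq> cube d" for b
    using Suc.prems(1) by (auto simp: Sl_def cube_def)
  have cons: "b # x \<in> cube (Suc d)" if "x \<in> cube d" for b x
    using that by (simp add: cube_def)
  have same: "S b * card (Sl b) \<le> K" for b
  proof (cases "Sl b = {}")
    case False
    show ?thesis unfolding S_def K_def
    proof (rule Suc.IH[OF Sl False])
      fix x a assume "x \<in> cube d" "a \<in> Sl b"
      then show "g (b # x) \<le> hdist d x a"
        using Suc.prems(3)[of "b # x" "b # a"] cons by (auto simp: Sl_def hdist_Cons)
    qed
  qed (use K in simp)
  have other: "S b * card (Sl (\<not> b)) \<le> s * K" for b
  proof (cases "Sl (\<not> b) = {}")
    case False
    have "S b \<le> (\<Sum>x\<in>cube d. s * s ^ (g (b # x) - 1))"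
      unfolding S_def
    proof (rule sum_mono)
      fix x
      show "s ^ g (b # x) \<le> s * s ^ (g (b # x) - 1)"
        using s by (cases "g (b # x)") auto
    qed
    also have "\<dots> = s * (\<Sum>x\<in>cube d. s ^ (g (b # x) - 1))"
      by (simp add: sum_distrib_left)
    finally have "S b * card (Sl (\<not> b)) \<le> s * ((\<Sum>x\<in>cube d. s ^ (g (b # x) - 1)) * card (Sl (\<not> b)))"
      by (metis mult.assoc mult_right_mono of_nat_0_le_iff)
    also have "\<dots> \<le> s * K" unfolding K_def
    proof (rule mult_left_mono, rule Suc.IH[OF Sl False])
      fix x a assume "x \<in> cube d" "a \<in> Sl (\<not> b)"
      then show "g (b # x) - 1 \<le> hdist d x a"
        using Suc.prems(3)[of "b # x" "(\<not> b) # a"] cons by (auto simp: Sl_def hdist_Cons)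
    qed (use s in simp)
    finally show ?thesis .
  qed (use K s in simp)
  have "A = (#) True ` Sl True \<union> (#) False ` Sl False"
    using Suc.prems(1) by (force simp: Sl_def cube_Suc)
  moreover have "card ((#) True ` Sl True \<union> (#) False ` Sl False) = card (Sl True) + card (Sl False)"
    using finite_subset[OF Sl finite_cube]
    by (subst card_Un_disjoint) (auto simp: card_image)
  ultimately have cA: "card A = card (Sl True) + card (Sl False)" by simp
  have fA: "finite A" using Suc.prems(1) finite_cube finite_subset by blast
  then have pos: "card (Sl True) > 0 \<or> card (Sl False) > 0"
    using cA Suc.prems(2) by (metis add_is_0 card_0_eq neq0_conv)
  have "(S True + S False) * (real (card (Sl True)) + card (Sl False)) \<le> (2 + s + 1/s) * K"
  proof (cases "card (Sl False) \<le> card (Sl True)")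
    case True
    show ?thesis
      by (rule slice_inequality) (use True pos s K same[of True] same[of False] other[of False] in auto)
  next
    case False
    have "(S False + S True) * (real (card (Sl False)) + card (Sl True)) \<le> (2 + s + 1/s) * K"
      by (rule slice_inequality) (use False pos s K same[of True] same[of False] other[of True] in auto)
    then show ?thesis by (simp add: add.commute)
  qed
  then show ?case by (simp add: sum_cube_Suc S_def K_def cA)
qed

text \<open>
  In dimension \<open>d = 84 j\<close> the points at distance at least \<open>d / 6\<close> from a set are rare. The base
  \<open>s = 4/3\<close> is close to optimal for this distance, and 84 makes the saving at least \<open>8\<close> per unit of
  \<open>j\<close>.
\<close>
lemma far_points_bound:
  assumes A: "A \<subseteq> cube (84 * j)"
  shows "real (card {x \<in> cube (84 * j). \<forall>a\<in>A. hdist (84 * j) x a \<ge> 14 * j}) * card A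
           \<le> (2 ^ (84 * j))\<^sup>2 / 8 ^ j"
proof (cases "A = {}")
  case False
  define F where "F = {x \<in> cube (84 * j). \<forall>a\<in>A. hdist (84 * j) x a \<ge> 14 * j}"
  define g where "g x = (if x \<in> F then 14 * j else 0)" for x
  have "(\<Sum>x\<in>cube (84 * j). (4/3::real) ^ g x) * card A \<le> (2 + 4/3 + 1/(4/3)) ^ (84 * j)"
    by (rule hamming_exponential_moment) (use A False in \<open>auto simp: g_def F_def\<close>)
  moreover have "(\<Sum>x\<in>cube (84 * j). (4/3::real) ^ g x) \<ge> (\<Sum>x\<in>F. (4/3) ^ (14 * j))"
  proof -
    have "(\<Sum>x\<in>F. (4/3::real) ^ (14 * j)) = (\<Sum>x\<in>F. (4/3) ^ g x)"
      by (simp add: g_def)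
    also have "\<dots> \<le> (\<Sum>x\<in>cube (84 * j). (4/3::real) ^ g x)"
      by (rule sum_mono2) (auto simp: finite_cube F_def)
    finally show ?thesis .
  qed
  ultimately have "(card F * (4/3::real) ^ (14 * j)) * card A \<le> (2 + 4/3 + 1/(4/3)) ^ (84 * j)"
    by (simp only: sum_constant) (meson mult_right_mono of_nat_0_le_iff order_trans)
  also have "2 + 4/3 + 1/(4/3) = (49/12::real)" by simp
  finally have "(card F * (4/3::real) ^ (14 * j)) * card A \<le> (49/12) ^ (84 * j)" .
  then have "real (card F) * card A \<le> (49/12) ^ (84 * j) / (4/3) ^ (14 * j)"
    by (simp add: field_simps)
  also have "\<dots> = ((49/12) ^ 84 / (4/3) ^ 14) ^ j"
    unfolding power_mult by (rule power_divide[symmetric])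
  also have "\<dots> \<le> ((2 ^ 84)\<^sup>2 / 8) ^ j"
  proof (rule power_mono)
    show "(49/12) ^ 84 / (4/3) ^ 14 \<le> (2 ^ 84)\<^sup>2 / (8::real)"
      unfolding power_divide by (simp add: divide_simps)
  qed simp
  also have "\<dots> = (2 ^ (84 * j))\<^sup>2 / 8 ^ j"
    unfolding power_mult power2_eq_square power_divide power_mult_distrib ..
  finally show ?thesis by (simp add: F_def)
qed simp

section \<open>Counting the runs of a process that rarely stagnates\<close>

text \<open>
  A process starts in a state \<open>s\<close> and is updated with a choice \<open>f u \<in> R\<close> for each \<open>u\<close> in \<open>us\<close>. As long
  as the process is active, only a fraction \<open>\<delta> u\<close> of the choices keeps it active and lowers the
  potential \<open>\<Phi>\<close> by less than \<open>h\<close>. At most \<open>T\<close> choices of a run can lower the potential by \<open>h\<close>, so all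
  others of an active run are improbable: every choice counts with weight \<open>\<delta> u\<close>, where the \<open>T\<close>
  exceptional ones are paid for by the factor \<open>1 / \<delta>0 ^ T\<close>, and the factor \<open>2\<close> accounts for the two
  kinds of choices.
\<close>
lemma count_active_runs:
  fixes R :: "'r set" and upd :: "'u \<Rightarrow> 'r \<Rightarrow> 's \<Rightarrow> 's" and \<Phi> :: "'s \<Rightarrow> nat"
    and \<delta> :: "'u \<Rightarrow> real"
  assumes fin: "finite R" and "distinct us" and d0: "0 < \<delta>0" "\<delta>0 \<le> 1" and h: "h > 0"
    and "\<And>u. u \<in> set us \<Longrightarrow> \<delta>0 \<le> \<delta> u"
    and act_mono: "\<And>u r s. act (upd u r s) \<Longrightarrow> act s"
    and Phi_mono: "\<And>u r s. \<Phi> (upd u r s) \<le> \<Phi> s"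
    and "\<And>u s. u \<in> set us \<Longrightarrow> act s \<Longrightarrow>
           real (card {r \<in> R. act (upd u r s) \<and> \<Phi> s < \<Phi> (upd u r s) + h}) \<le> \<delta> u * card R"
    and "\<Phi> s \<le> h * T"
  shows "real (card {f \<in> PiE (set us) (\<lambda>_. R). act (fold (\<lambda>u. upd u (f u)) us s)})
           \<le> (\<Prod>u\<in>set us. 2 * \<delta> u) / \<delta>0 ^ T * real (card R) ^ length us"
  using assms(2,6,9,10)
proof (induction us arbitrary: s T)
  case Nil
  let ?E = "{f \<in> PiE ({} :: 'u set) (\<lambda>_. R). act s}"
  have "card ?E \<le> card {\<lambda>x :: 'u. undefined :: 'r}"
    by (rule card_mono) auto
  then have "card ?E \<le> 1" by simp
  moreover have "1 / \<delta>0 ^ T \<ge> 1" using d0 by (simp add: power_le_one)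
  ultimately show ?case
    by (simp only: set_simps fold_Nil id_apply prod.empty list.size power_0)
next
  case (Cons u us)
  define cnt where "cnt r = {f \<in> PiE (set us) (\<lambda>_. R). act (fold (\<lambda>u. upd u (f u)) us (upd u r s))}" for r
  define X where "X = (\<Prod>u\<in>set us. 2 * \<delta> u) / \<delta>0 ^ T * real (card R) ^ length us"
  have du: "\<delta>0 \<le> \<delta> u" using Cons.prems(2) by simp
  have pos: "(\<Prod>u\<in>set us. 2 * \<delta> u) \<ge> 0"
    by (rule prod_nonneg) (use Cons.prems(2) d0 in \<open>force\<close>)
  then have X: "X \<ge> 0" using d0 by (simp add: X_def)
  have act_back: "act s'" if "act (fold (\<lambda>u. upd u (f u)) vs s')" for f vs s'
    using that by (induction vs arbitrary: s') (auto dest: act_mono)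
  have finP: "finite (PiE (set us) (\<lambda>_. R))" by (simp add: finite_PiE fin)
  have fc: "finite (cnt r)" for r unfolding cnt_def using finP by simp
  have IH: "real (card (cnt r)) \<le> (\<Prod>u\<in>set us. 2 * \<delta> u) / \<delta>0 ^ T' * real (card R) ^ length us"
    if "\<Phi> (upd u r s) \<le> h * T'" for r T'
    unfolding cnt_def
    by (rule Cons.IH) (use Cons.prems that in auto)
  let ?A = "{f \<in> PiE (set (u # us)) (\<lambda>_. R). act (fold (\<lambda>u. upd u (f u)) (u # us) s)}"
  have sub: "?A \<subseteq> (\<Union>r\<in>R. (\<lambda>f. f(u := r)) ` cnt r)"
  proof
    fix f assume f: "f \<in> ?A"
    have u: "u \<notin> set us" using Cons.prems(1) by simp
    let ?f = "f(u := undefined)"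
    have "fold (\<lambda>v. upd v (f v)) us t = fold (\<lambda>v. upd v (?f v)) us t" for t
      by (rule fold_cong) (use u in auto)
    then have "?f \<in> cnt (f u)"
      using f u by (auto simp: cnt_def PiE_iff extensional_def)
    moreover have "f = ?f(u := f u)" by simp
    moreover have "f u \<in> R" using f by (auto simp: PiE_iff)
    ultimately show "f \<in> (\<Union>r\<in>R. (\<lambda>f. f(u := r)) ` cnt r)" by blast
  qed
  have "card ?A \<le> card (\<Union>r\<in>R. (\<lambda>f. f(u := r)) ` cnt r)"
    by (rule card_mono[OF _ sub]) (use fin fc in auto)
  also have "\<dots> \<le> (\<Sum>r\<in>R. card ((\<lambda>f. f(u := r)) ` cnt r))"
    by (rule card_UN_le[OF fin])
  also have "\<dots> \<le> (\<Sum>r\<in>R. card (cnt r))"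
    by (rule sum_mono) (rule card_image_le[OF fc])
  finally have le: "real (card ?A) \<le> (\<Sum>r\<in>R. real (card (cnt r)))"
    by (simp only: of_nat_le_iff flip: of_nat_sum)
  define Lz where "Lz = {r \<in> R. act (upd u r s) \<and> \<Phi> s < \<Phi> (upd u r s) + h}"
  have b1: "real (card (cnt r)) \<le> (if r \<in> Lz then X else 0) + \<delta> u * X" if r: "r \<in> R" for r
  proof (cases "act (upd u r s)")
    case False
    then have "cnt r = {}" using act_back by (auto simp: cnt_def)
    then show ?thesis using X du d0 by simp
  next
    case act: True
    show ?thesis
    proof (cases "r \<in> Lz")
      case True
      have "\<Phi> (upd u r s) \<le> h * T" using Phi_mono Cons.prems(4) order_trans by blast
      then have "real (card (cnt r)) \<le> X" unfolding X_def by (rule IH)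
      then show ?thesis using True X du d0 by (simp add: add_increasing2)
    next
      case False
      then have dec: "\<Phi> (upd u r s) + h \<le> \<Phi> s" using act r by (auto simp: Lz_def)
      then obtain T' where T': "T = Suc T'"
        using Cons.prems(4) h by (cases T) auto
      have "\<Phi> (upd u r s) \<le> h * T'" using dec Cons.prems(4) T' by auto
      then have "real (card (cnt r)) \<le> (\<Prod>u\<in>set us. 2 * \<delta> u) / \<delta>0 ^ T' * real (card R) ^ length us"
        by (rule IH)
      also have "\<dots> = \<delta>0 * X" using d0 by (simp add: X_def T')
      also have "\<dots> \<le> \<delta> u * X" using du X by (rule mult_right_mono)
      finally show ?thesis using False by simp
    qed
  qed
  have "(\<Sum>r\<in>R. real (card (cnt r))) \<le> (\<Sum>r\<in>R. (if r \<in> Lz then X else 0) + \<delta> u * X)"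
    by (rule sum_mono) (rule b1)
  also have "\<dots> = card Lz * X + card R * (\<delta> u * X)"
  proof -
    have "R \<inter> Lz = Lz" by (auto simp: Lz_def)
    then show ?thesis by (simp add: sum.distrib sum.If_cases fin)
  qed
  also have "\<dots> \<le> (\<delta> u * card R) * X + card R * (\<delta> u * X)"
  proof (cases "act s")
    case True
    then have "real (card Lz) \<le> \<delta> u * card R" unfolding Lz_def using Cons.prems(3) by simp
    then show ?thesis using X by (intro add_right_mono mult_right_mono)
  next
    case False
    then have "Lz = {}" using act_mono by (auto simp: Lz_def)
    then show ?thesis using X du d0 by simp
  qed
  also have "\<dots> = (\<Prod>u\<in>set (u # us). 2 * \<delta> u) / \<delta>0 ^ T * real (card R) ^ length (u # us)"
    using Cons.prems(1) by (simp add: X_def)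
  finally show ?case using le by linarith
qed

text \<open>Counting by revealing the values on \<open>I\<close> first, a Fubini theorem for counting.\<close>
lemma card_PiE_union_le:
  assumes IJ: "finite I" "finite J" "I \<inter> J = {}" and C: "finite C"
  shows "card {g \<in> PiE (I \<union> J) (\<lambda>_. C). Q (restrict g I) (restrict g J)}
           \<le> (\<Sum>f\<in>PiE I (\<lambda>_. C). card {f' \<in> PiE J (\<lambda>_. C). Q f f'})"
proof -
  let ?L = "{g \<in> PiE (I \<union> J) (\<lambda>_. C). Q (restrict g I) (restrict g J)}"
  let ?S = "SIGMA f : PiE I (\<lambda>_. C). {f' \<in> PiE J (\<lambda>_. C). Q f f'}"
  have fin: "finite (PiE I (\<lambda>_. C))" "finite (PiE J (\<lambda>_. C))"
    using IJ C by (simp_all add: finite_PiE)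
  have "card ?L \<le> card ?S"
  proof (rule card_inj_on_le[of "\<lambda>g. (restrict g I, restrict g J)"])
    show "inj_on (\<lambda>g. (restrict g I, restrict g J)) ?L"
    proof (rule inj_onI)
      fix g g' assume g: "g \<in> ?L" "g' \<in> ?L"
        and eq: "(restrict g I, restrict g J) = (restrict g' I, restrict g' J)"
      show "g = g'"
      proof (rule PiE_ext[of g "I \<union> J" "\<lambda>_. C"])
        fix t assume "t \<in> I \<union> J"
        moreover have "restrict g I t = restrict g' I t" "restrict g J t = restrict g' J t"
          using eq by auto
        ultimately show "g t = g' t" by auto
      qed (use g in auto)
    qed
    show "(\<lambda>g. (restrict g I, restrict g J)) ` ?L \<subseteq> ?S"
      by auto
    show "finite ?S" using fin by auto
  qed
  also have "\<dots> = (\<Sum>f\<in>PiE I (\<lambda>_. C). card {f' \<in> PiE J (\<lambda>_. C). Q f f'})"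
    using fin by (simp add: card_SigmaI)
  finally show ?thesis .
qed

section \<open>Colourings of pairs by a set without empty boxes\<close>

lemma initial_segment_subset:
  fixes S :: "'a :: linorder set"
  assumes "finite S" "k \<le> card S"
  shows "\<exists>A \<subseteq> S. card A = k \<and> (\<forall>a\<in>A. \<forall>b\<in>S - A. a < b)"
  using assms(2)
proof (induction k)
  case 0
  then show ?case by (intro exI[of _ "{}"]) auto
next
  case (Suc k)
  then obtain A where A: "A \<subseteq> S" "card A = k" "\<forall>a\<in>A. \<forall>b\<in>S - A. a < b" by auto
  then have ne: "S - A \<noteq> {}" "finite (S - A)" using Suc.prems assms(1) by auto
  define x where "x = Min (S - A)"
  have x: "x \<in> S - A" "\<And>y. y \<in> S - A \<Longrightarrow> x \<le> y"
    using Min_in[OF ne(2,1)] Min_le[OF ne(2)] by (simp_all add: x_def)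
  have "card (insert x A) = Suc k" using A x assms(1) finite_subset by (subst card_insert_disjoint) auto
  moreover have "\<forall>a\<in>insert x A. \<forall>b\<in>S - insert x A. a < b"
    using A x by (auto simp: less_le)
  ultimately show ?case using A(1) x(1) by (intro exI[of _ "insert x A"]) auto
qed

lemma prod_two_step:
  assumes "finite B" "L \<subseteq> B"
  shows "(\<Prod>v\<in>B. 2 * (if v \<in> L then \<theta> else 1)) = 2 ^ card B * (\<theta>::real) ^ card L"
proof -
  have "B \<inter> L = L" using assms by auto
  then show ?thesis using assms by (simp add: prod.distrib prod.If_cases)
qed

text \<open>
  \<open>C\<close> is the set of colours of pairs, and \<open>R x y z\<close> says that a triple \<open>a < b < c\<close> with colours
  \<open>x\<close> on \<open>ab\<close>, \<open>y\<close> on \<open>ac\<close> and \<open>z\<close> on \<open>bc\<close> is an edge. The edges are so frequent that \<open>R\<close>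
  meets every box with sides of density more than \<open>\<theta>\<close>. Sets of \<open>3 m\<close> vertices are going to be split
  into thirds of size \<open>m = 128 D\<^sup>2\<close>. This is chosen for the sake of the potentials of the two processes
  below, which are \<open>D H = 16 D\<^sup>2\<close> in \<open>few_hits_count\<close> for \<open>H = 16 D\<close> and \<open>m\<^sup>2 D\<close> in \<open>dense_rows_count\<close>: they are used up by
  at most half of the steps. The bound on \<open>\<theta>\<close> makes factors \<open>2 ^ m\<close> negligible.
\<close>
locale box_hitting =
  fixes C :: "'c set" and R :: "'c \<Rightarrow> 'c \<Rightarrow> 'c \<Rightarrow> bool" and \<theta> :: real and D m :: nat
  assumes finite_C: "finite C" and card_C: "card C = D" and D_pos: "D > 0"
    and m_eq: "m = 128 * D\<^sup>2"
    and \<theta>: "0 < \<theta>" "\<theta> \<le> 1 / 2 ^ 32"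
    and hit: "\<And>X Y Z. X \<subseteq> C \<Longrightarrow> Y \<subseteq> C \<Longrightarrow> Z \<subseteq> C \<Longrightarrow> \<theta> * D < card X \<Longrightarrow> \<theta> * D < card Y
                \<Longrightarrow> \<theta> * D < card Z \<Longrightarrow> \<exists>x\<in>X. \<exists>y\<in>Y. \<exists>z\<in>Z. R x y z"
begin

definition big :: "'c set \<Rightarrow> bool" where
  "big X \<longleftrightarrow> \<theta> * D < card (X \<inter> C)"

lemma big_mono: "big X \<Longrightarrow> X \<subseteq> Y \<Longrightarrow> big Y"
proof -
  assume "big X" "X \<subseteq> Y"
  then have "card (X \<inter> C) \<le> card (Y \<inter> C)" by (intro card_mono) (use finite_C in auto)
  then show "big Y" using \<open>big X\<close> unfolding big_def by linarith
qed

lemma theta_le_1: "\<theta> \<le> 1" using \<theta> by simp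

text \<open>
  Here \<open>w \<in> B'\<close> and \<open>u \<in> A\<close> are fixed, \<open>S v\<close> is the set of colours that are still available for
  \<open>vw\<close>, and \<open>x v\<close> is the colour of \<open>uv\<close>. A colour \<open>y\<close> of \<open>uw\<close> hits \<open>v\<close> if it makes some colour in \<open>S v\<close>
  unavailable. While the set of colours \<open>y\<close> with few hits is big, the hitting property for this set,
  the big set \<open>S v\<close> and the set of colours \<open>x v\<close> without effect shows that almost every choice
  of \<open>x v\<close> increases the number of hits of some \<open>y\<close> with few hits. This can happen at most \<open>D H\<close> times.
\<close>
lemma few_hits_count:
  assumes B: "finite B" and L: "L \<subseteq> B" "\<And>v. v \<in> L \<Longrightarrow> big (S v)"
  shows "real (card {x \<in> PiE B (\<lambda>_. C). big {y. card {v \<in> B. \<exists>z\<in>S v \<inter> C. R (x v) y z} < H}})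
           \<le> 2 ^ card B * \<theta> ^ card L / \<theta> ^ (D * H) * real D ^ card B"
proof -
  obtain vs where vs: "set vs = B" "distinct vs"
    using finite_distinct_list[OF B] by blast
  define ht where "ht v x y \<longleftrightarrow> (\<exists>z\<in>S v \<inter> C. R x y z)" for v x y
  define upd where "upd v x c = (\<lambda>y. c y + (if ht v x y then 1 else 0 :: nat))" for v x c
  define act where "act c \<longleftrightarrow> big {y. c y < H}" for c :: "'c \<Rightarrow> nat"
  define \<Phi> where "\<Phi> c = (\<Sum>y\<in>C. H - c y)" for c :: "'c \<Rightarrow> nat"
  define \<delta> where "\<delta> v = (if v \<in> L then \<theta> else 1)" for v
  have fold_upd: "fold (\<lambda>v. upd v (x v)) us c y = c y + card {v \<in> set us. ht v (x v) y}"
    if "distinct us" for us x c y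
    using that
  proof (induction us arbitrary: c)
    case (Cons u us)
    have "{v \<in> set (u # us). ht v (x v) y}
        = (if ht u (x u) y then insert u {v \<in> set us. ht v (x v) y} else {v \<in> set us. ht v (x v) y})"
      by auto
    then show ?case using Cons by (simp add: upd_def)
  qed simp
  have "real (card {x \<in> PiE (set vs) (\<lambda>_. C). act (fold (\<lambda>v. upd v (x v)) vs (\<lambda>_. 0))})
      \<le> (\<Prod>v\<in>set vs. 2 * \<delta> v) / \<theta> ^ (D * H) * real (card C) ^ length vs"
  proof (rule count_active_runs[where h = 1 and \<Phi> = \<Phi>])
    fix v x c
    show "act (upd v x c) \<Longrightarrow> act c"
      unfolding act_def by (erule big_mono) (auto simp: upd_def)
    show "\<Phi> (upd v x c) \<le> \<Phi> c"
      unfolding \<Phi>_def by (rule sum_mono) (auto simp: upd_def)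
  next
    fix v c assume v: "v \<in> set vs" and "act c"
    let ?X = "{x \<in> C. act (upd v x c) \<and> \<Phi> c < \<Phi> (upd v x c) + 1}"
    show "real (card ?X) \<le> \<delta> v * card C"
    proof (cases "v \<in> L")
      case False
      then show ?thesis using card_mono[of C ?X] finite_C by (simp add: \<delta>_def)
    next
      case True
      show ?thesis
      proof (rule ccontr)
        assume "\<not> ?thesis"
        then have X: "\<theta> * D < card ?X" using True by (simp add: \<delta>_def card_C)
        have "\<exists>x\<in>?X. \<exists>y\<in>{y. c y < H} \<inter> C. \<exists>z\<in>S v \<inter> C. R x y z"
          by (rule hit) (use X \<open>act c\<close> L True in \<open>auto simp: act_def big_def\<close>)
        then obtain x y where x: "x \<in> ?X" and y: "y \<in> C" "c y < H" "ht v x y"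
          unfolding ht_def by blast
        have "\<Phi> (upd v x c) < \<Phi> c"
          unfolding \<Phi>_def
          by (rule sum_strict_mono_ex1) (use finite_C y in \<open>auto simp: upd_def intro!: bexI[of _ y]\<close>)
        then show False using x by simp
      qed
    qed
  qed (use vs finite_C \<theta> theta_le_1 in \<open>auto simp: \<delta>_def \<Phi>_def card_C\<close>)
  also have "(\<Prod>v\<in>set vs. 2 * \<delta> v) = 2 ^ card B * \<theta> ^ card L"
    unfolding \<delta>_def vs using B L(1) by (rule prod_two_step)
  finally show ?thesis
    using vs by (simp add: act_def fold_upd ht_def card_C distinct_card[symmetric])
qed

text \<open>
  A large deviation bound: each \<open>y w\<close> with \<open>w \<in> L\<close> falls into a set of density at most \<open>\<theta>\<close>. The process
  counts down from \<open>b\<close> the indices for which this fails, and is active while the count is positive.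
\<close>
lemma few_escapes_count:
  assumes B: "finite B" and L: "L \<subseteq> B" "\<And>w. w \<in> L \<Longrightarrow> \<not> big (U w)"
  shows "real (card {y \<in> PiE B (\<lambda>_. C). card {w \<in> L. y w \<notin> U w} < b})
           \<le> 2 ^ card B * \<theta> ^ card L / \<theta> ^ b * real D ^ card B"
proof -
  obtain ws where ws: "set ws = B" "distinct ws"
    using finite_distinct_list[OF B] by blast
  define upd where "upd w y k = (if w \<in> L \<and> y \<notin> U w then k - 1 else k)" for w y and k :: nat
  define \<delta> where "\<delta> w = (if w \<in> L then \<theta> else 1)" for w
  have fold_upd: "fold (\<lambda>w. upd w (y w)) us k = k - card {w \<in> set us. w \<in> L \<and> y w \<notin> U w}"
    if "distinct us" for us y k
    using that
  proof (induction us arbitrary: k)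
    case (Cons u us)
    have "{w \<in> set (u # us). w \<in> L \<and> y w \<notin> U w}
        = (if u \<in> L \<and> y u \<notin> U u then insert u {w \<in> set us. w \<in> L \<and> y w \<notin> U w}
           else {w \<in> set us. w \<in> L \<and> y w \<notin> U w})"
      by auto
    then show ?case using Cons by (simp add: upd_def)
  qed simp
  have "real (card {y \<in> PiE (set ws) (\<lambda>_. C). 0 < fold (\<lambda>w. upd w (y w)) ws b})
      \<le> (\<Prod>w\<in>set ws. 2 * \<delta> w) / \<theta> ^ b * real (card C) ^ length ws"
  proof (rule count_active_runs[where h = 1 and \<Phi> = id and act = "\<lambda>k. 0 < k"])
    fix w and k :: nat assume "0 < k"
    let ?X = "{y \<in> C. 0 < upd w y k \<and> id k < id (upd w y k) + 1}"
    show "real (card ?X) \<le> \<delta> w * card C"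
    proof (cases "w \<in> L")
      case False
      then show ?thesis using card_mono[of C ?X] finite_C by (simp add: \<delta>_def)
    next
      case True
      have "?X \<subseteq> U w \<inter> C" using True \<open>0 < k\<close> by (auto simp: upd_def split: if_splits)
      then have "card ?X \<le> card (U w \<inter> C)" by (intro card_mono) (use finite_C in auto)
      then show ?thesis using L(2)[OF True] True by (simp add: \<delta>_def card_C big_def)
    qed
  qed (use ws finite_C \<theta> theta_le_1 in \<open>auto simp: \<delta>_def upd_def split: if_splits\<close>)
  also have "(\<Prod>w\<in>set ws. 2 * \<delta> w) = 2 ^ card B * \<theta> ^ card L"
    unfolding \<delta>_def ws using B L(1) by (rule prod_two_step)
  also have "{y \<in> PiE (set ws) (\<lambda>_. C). 0 < fold (\<lambda>w. upd w (y w)) ws b}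
      = {y \<in> PiE B (\<lambda>_. C). card {w \<in> L. y w \<notin> U w} < b}"
  proof -
    have "{w \<in> B. w \<in> L \<and> y w \<notin> U w} = {w \<in> L. y w \<notin> U w}" for y using L by auto
    then show ?thesis using ws by (auto simp: fold_upd)
  qed
  finally show ?thesis
    using ws by (simp add: card_C distinct_card[symmetric])
qed

text \<open>Both sides have size \<open>m\<close> in all applications, so that \<open>m\<^sup>2\<close> is the number of all pairs.\<close>
definition dense_on :: "'v set \<Rightarrow> 'v set \<Rightarrow> ('v \<times> 'v \<Rightarrow> 'c set) \<Rightarrow> bool" where
  "dense_on B B' W \<longleftrightarrow> m\<^sup>2 < 2 * card {p \<in> B \<times> B'. big (W p)}"

lemma theta_power_bound: "(2::real) ^ (32 * k) * \<theta> ^ k \<le> 1"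
proof -
  have "(2::real) ^ (32 * k) * \<theta> ^ k = (2 ^ 32 * \<theta>) ^ k"
    by (simp add: power_mult power_mult_distrib)
  also have "\<dots> \<le> 1" using \<theta> by (intro power_le_one) (auto simp: field_simps)
  finally show ?thesis .
qed

lemma theta_power_antimono: "a \<le> b \<Longrightarrow> \<theta> ^ b \<le> \<theta> ^ a"
  using \<theta> theta_le_1 by (intro power_decreasing) auto

lemma m_pos: "m > 0" using m_eq D_pos by simp

text \<open>
  Double counting: a column in which fewer than a quarter of the sets are big contributes less than
  \<open>m / 4\<close>, so more than a quarter of the columns are needed to reach \<open>m\<^sup>2 / 2\<close>.
\<close>
lemma many_active_columns:
  assumes B: "finite B" "finite B'" "card B = m" "card B' = m" and "dense_on B B' W"
  shows "m \<le> 4 * card {w \<in> B'. m \<le> 4 * card {v \<in> B. big (W (v, w))}}"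
proof -
  let ?L = "\<lambda>w. {v \<in> B. big (W (v, w))}"
  let ?A = "{w \<in> B'. m \<le> 4 * card (?L w)}"
  have eq: "{p \<in> B \<times> B'. big (W p)} = (\<lambda>(w, v). (v, w)) ` (SIGMA w : B'. ?L w)"
    by force
  have "inj_on (\<lambda>(w, v). (v, w)) (SIGMA w : B'. ?L w)"
    by (auto simp: inj_on_def)
  then have "card {p \<in> B \<times> B'. big (W p)} = (\<Sum>w\<in>B'. card (?L w))"
    unfolding eq using B by (simp add: card_image card_SigmaI)
  then have "4 * card {p \<in> B \<times> B'. big (W p)} = (\<Sum>w\<in>B'. 4 * card (?L w))"
    by (simp add: sum_distrib_left)
  also have "\<dots> \<le> (\<Sum>w\<in>B'. (if w \<in> ?A then 4 * m else 0) + m)"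
  proof (rule sum_mono)
    fix w
    have "card (?L w) \<le> m" using B card_mono[of B "?L w"] by auto
    moreover assume "w \<in> B'"
    ultimately show "4 * card (?L w) \<le> (if w \<in> ?A then 4 * m else 0) + m" by auto
  qed
  also have "\<dots> = card ?A * (4 * m) + m * m"
  proof -
    have "B' \<inter> ?A = ?A" by auto
    then show ?thesis using B by (simp only: sum.distrib sum.If_cases) simp
  qed
  finally have "4 * card {p \<in> B \<times> B'. big (W p)} \<le> card ?A * (4 * m) + m * m" .
  moreover have "m * m < 2 * card {p \<in> B \<times> B'. big (W p)}"
    using assms(5) by (simp add: dense_on_def power2_eq_square)
  ultimately have "m * m < card ?A * (4 * m)" by linarith
  also have "\<dots> = (4 * card ?A) * m" by (simp only: ac_simps)
  finally have "m < 4 * card ?A" by (simp only: mult_less_cancel2)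
  then show ?thesis by (rule less_imp_le)
qed

text \<open>
  A row \<open>r\<close> consists of the colours of the pairs \<open>ut\<close> with \<open>t \<in> B \<union> B'\<close> for one vertex \<open>u \<in> A\<close>. It is
  lazy if it shrinks fewer than \<open>2 D m\<close> of the sets \<open>W (v, w)\<close>. First reveal \<open>r\<close> on \<open>B\<close>: for
  each of the at least \<open>m / 4\<close> active columns \<open>w\<close>, all but a small set of values \<open>r w\<close> will shrink at
  least \<open>16 D\<close> of the sets in the column, unless the exceptional event of \<open>few_hits_count\<close> occurs. Then
  reveal \<open>r\<close> on \<open>B'\<close>: a lazy row has to meet the small set in all but \<open>m / 8 = 16 D\<^sup>2\<close> of the
  active columns.
\<close>
lemma lazy_rows_count:
  assumes B: "finite B" "finite B'" "card B = m" "card B' = m" "B \<inter> B' = {}"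
    and dense: "dense_on B B' W"
  shows "real (card {r \<in> PiE (B \<union> B') (\<lambda>_. C).
            card {(v, w) \<in> B \<times> B'. \<exists>z\<in>W (v, w) \<inter> C. R (r v) (r w) z} < 2 * D * m})
         \<le> \<theta> ^ (8 * D\<^sup>2) * card (PiE (B \<union> B') (\<lambda>_. C))"
proof -
  define L where "L w = {v \<in> B. big (W (v, w))}" for w
  define Ac where "Ac = {w \<in> B'. m \<le> 4 * card (L w)}"
  define U where "U x w = {y. card {v \<in> B. \<exists>z\<in>W (v, w) \<inter> C. R (x v) y z} < 16 * D}" for x w
  (* The colourings of B to which few_hits_count applies in some active column. *)
  define E where "E = {x \<in> PiE B (\<lambda>_. C). \<exists>w\<in>Ac. big (U x w)}"
  define rem where "rem x y = {(v, w) \<in> B \<times> B'. \<exists>z\<in>W (v, w) \<inter> C. R (x v) (y w) z}" for x y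
  (* The number of exceptional colourings of B, for a single column, and the number of lazy colourings
     of B' that extend an unexceptional one are both at most \<epsilon> D ^ m. *)
  define \<epsilon> where "\<epsilon> = 2 ^ m * \<theta> ^ (16 * D\<^sup>2)"
  have Ac: "m \<le> 4 * card Ac" "Ac \<subseteq> B'"
    using many_active_columns[OF B(1-4) dense] by (auto simp: Ac_def L_def)
  have \<epsilon>: "\<epsilon> \<ge> 0" using \<theta> by (simp add: \<epsilon>_def)
  have finAc: "finite Ac" using Ac B finite_subset by blast
  have powers: "2 ^ m * \<theta> ^ k / \<theta> ^ (16 * D\<^sup>2) \<le> \<epsilon>" if "m \<le> 4 * k" for k
  proof -
    have "\<theta> ^ k \<le> \<theta> ^ (16 * D\<^sup>2 + 16 * D\<^sup>2)"
      by (rule theta_power_antimono) (use that m_eq in simp)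
    then have "\<theta> ^ k / \<theta> ^ (16 * D\<^sup>2) \<le> \<theta> ^ (16 * D\<^sup>2)"
      using \<theta>(1) by (simp only: power_add pos_divide_le_eq zero_less_power)
    then show ?thesis by (simp add: \<epsilon>_def flip: times_divide_eq_right)
  qed
  have E_sub: "E \<subseteq> (\<Union>w\<in>Ac. {x \<in> PiE B (\<lambda>_. C). big (U x w)})" by (auto simp: E_def)
  have one: "real (card {x \<in> PiE B (\<lambda>_. C). big (U x w)}) \<le> \<epsilon> * real D ^ m" if "w \<in> Ac" for w
  proof -
    have "real (card {x \<in> PiE B (\<lambda>_. C). big (U x w)})
        \<le> 2 ^ card B * \<theta> ^ card (L w) / \<theta> ^ (D * (16 * D)) * real D ^ card B"
      unfolding U_def by (rule few_hits_count) (use B in \<open>auto simp: L_def\<close>)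
    also have "D * (16 * D) = 16 * D\<^sup>2" by (simp add: power2_eq_square)
    also have "2 ^ card B * \<theta> ^ card (L w) / \<theta> ^ (16 * D\<^sup>2) * real D ^ card B \<le> \<epsilon> * real D ^ m"
      unfolding B by (rule mult_right_mono[OF powers]) (use that in \<open>auto simp: Ac_def\<close>)
    finally show ?thesis .
  qed
  have "card E \<le> card (\<Union>w\<in>Ac. {x \<in> PiE B (\<lambda>_. C). big (U x w)})"
    by (rule card_mono[OF _ E_sub]) (use B finite_C finAc in \<open>auto simp: finite_PiE\<close>)
  also have "\<dots> \<le> (\<Sum>w\<in>Ac. card {x \<in> PiE B (\<lambda>_. C). big (U x w)})"
    by (rule card_UN_le[OF finAc])
  finally have "real (card E) \<le> (\<Sum>w\<in>Ac. real (card {x \<in> PiE B (\<lambda>_. C). big (U x w)}))"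
    by (simp only: of_nat_le_iff flip: of_nat_sum)
  also have "\<dots> \<le> (\<Sum>w\<in>Ac. \<epsilon> * real D ^ m)" by (rule sum_mono) (rule one)
  also have "\<dots> \<le> m * (\<epsilon> * real D ^ m)"
    using card_mono[OF B(2) Ac(2)] B(4) \<epsilon> by (simp add: mult_right_mono)
  finally have cE: "real (card E) \<le> m * (\<epsilon> * real D ^ m)" .
  have second: "real (card {y \<in> PiE B' (\<lambda>_. C). card (rem x y) < 2 * D * m})
      \<le> (if x \<in> E then real D ^ m else 0) + \<epsilon> * real D ^ m" if x: "x \<in> PiE B (\<lambda>_. C)" for x
  proof (cases "x \<in> E")
    case True
    have "card {y \<in> PiE B' (\<lambda>_. C). card (rem x y) < 2 * D * m} \<le> card (PiE B' (\<lambda>_. C))"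
      by (rule card_mono) (use B finite_C in \<open>auto simp: finite_PiE\<close>)
    also have "\<dots> = D ^ m" using B by (simp add: card_PiE card_C)
    finally have "real (card {y \<in> PiE B' (\<lambda>_. C). card (rem x y) < 2 * D * m}) \<le> real D ^ m"
      by (simp only: of_nat_le_iff flip: of_nat_power)
    then show ?thesis using True \<epsilon> by (simp add: add_increasing2)
  next
    case False
    have sub: "{y \<in> PiE B' (\<lambda>_. C). card (rem x y) < 2 * D * m}
        \<subseteq> {y \<in> PiE B' (\<lambda>_. C). card {w \<in> Ac. y w \<notin> U x w} < 16 * D\<^sup>2}"
    proof clarify
      fix y assume y: "y \<in> PiE B' (\<lambda>_. C)" and few: "card (rem x y) < 2 * D * m"
      let ?esc = "{w \<in> Ac. y w \<notin> U x w}"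
      let ?hits = "\<lambda>w. {v \<in> B. \<exists>z\<in>W (v, w) \<inter> C. R (x v) (y w) z}"
      have "card ?esc * (16 * D) \<le> (\<Sum>w\<in>?esc. card (?hits w))"
      proof -
        have "(\<Sum>w\<in>?esc. 16 * D) \<le> (\<Sum>w\<in>?esc. card (?hits w))"
          by (rule sum_mono) (auto simp: U_def)
        then show ?thesis by simp
      qed
      also have "\<dots> = card ((\<lambda>(w, v). (v, w)) ` (SIGMA w : ?esc. ?hits w))"
      proof -
        have "inj_on (\<lambda>(w, v). (v, w)) (SIGMA w : ?esc. ?hits w)"
          by (auto simp: inj_on_def)
        then show ?thesis using B finAc by (simp add: card_image card_SigmaI)
      qed
      also have "\<dots> \<le> card (rem x y)"
      proof (rule card_mono)
        have "rem x y \<subseteq> B \<times> B'" by (auto simp: rem_def)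
        then show "finite (rem x y)" using B finite_subset by blast
        show "(\<lambda>(w, v). (v, w)) ` (SIGMA w : ?esc. ?hits w) \<subseteq> rem x y"
          using Ac(2) by (auto simp: rem_def)
      qed
      also have "\<dots> < 16 * D\<^sup>2 * (16 * D)"
        using few by (simp add: m_eq power2_eq_square)
      finally show "card ?esc < 16 * D\<^sup>2" using D_pos by simp
    qed
    have "real (card {y \<in> PiE B' (\<lambda>_. C). card (rem x y) < 2 * D * m})
        \<le> real (card {y \<in> PiE B' (\<lambda>_. C). card {w \<in> Ac. y w \<notin> U x w} < 16 * D\<^sup>2})"
      by (rule of_nat_mono, rule card_mono[OF _ sub]) (use B finite_C in \<open>auto simp: finite_PiE\<close>)
    also have "\<dots> \<le> 2 ^ card B' * \<theta> ^ card Ac / \<theta> ^ (16 * D\<^sup>2) * real D ^ card B'"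
      by (rule few_escapes_count) (use False x Ac B in \<open>auto simp: E_def\<close>)
    also have "\<dots> \<le> \<epsilon> * real D ^ m"
      unfolding B by (rule mult_right_mono[OF powers]) (use Ac in auto)
    finally show ?thesis using False by simp
  qed
  let ?bad = "{r \<in> PiE (B \<union> B') (\<lambda>_. C). card (rem (restrict r B) (restrict r B')) < 2 * D * m}"
  have "rem (restrict r B) (restrict r B') = {(v, w) \<in> B \<times> B'. \<exists>z\<in>W (v, w) \<inter> C. R (r v) (r w) z}" for r
    by (auto simp: rem_def)
  then have "real (card {r \<in> PiE (B \<union> B') (\<lambda>_. C).
            card {(v, w) \<in> B \<times> B'. \<exists>z\<in>W (v, w) \<inter> C. R (r v) (r w) z} < 2 * D * m})
      = real (card ?bad)" by simp
  also have "\<dots> \<le> real (\<Sum>x\<in>PiE B (\<lambda>_. C). card {y \<in> PiE B' (\<lambda>_. C). card (rem x y) < 2 * D * m})"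
    by (rule of_nat_mono) (rule card_PiE_union_le[OF B(1,2,5) finite_C])
  also have "\<dots> \<le> (\<Sum>x\<in>PiE B (\<lambda>_. C). (if x \<in> E then real D ^ m else 0) + \<epsilon> * real D ^ m)"
    unfolding of_nat_sum by (rule sum_mono) (rule second)
  also have "\<dots> = card E * real D ^ m + real D ^ m * (\<epsilon> * real D ^ m)"
  proof -
    have "PiE B (\<lambda>_. C) \<inter> E = E" by (auto simp: E_def)
    moreover have "card (PiE B (\<lambda>_. C)) = D ^ m" using B by (simp add: card_PiE card_C)
    ultimately show ?thesis
      using finite_PiE[OF B(1), of "\<lambda>_. C"] finite_C by (simp add: sum.distrib sum.If_cases)
  qed
  also have "\<dots> \<le> m * (\<epsilon> * real D ^ m) * real D ^ m + real D ^ m * (\<epsilon> * real D ^ m)"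
    using cE by (simp add: mult_right_mono)
  also have "\<dots> = ((real m + 1) * \<epsilon>) * (real D ^ m * real D ^ m)"
    by (simp add: algebra_simps)
  also have "\<dots> \<le> \<theta> ^ (8 * D\<^sup>2) * (real D ^ m * real D ^ m)"
  proof (rule mult_right_mono)
    have "Suc m \<le> 2 ^ m" by (rule Suc_leI) (rule less_exp)
    then have "real (Suc m) \<le> real (2 ^ m)" by (rule of_nat_mono)
    then have "real m + 1 \<le> 2 ^ m" by simp
    then have "(real m + 1) * \<epsilon> \<le> 2 ^ m * \<epsilon>"
      using \<epsilon> by (rule mult_right_mono)
    also have "\<dots> = (2 ^ (32 * (8 * D\<^sup>2)) * \<theta> ^ (8 * D\<^sup>2)) * \<theta> ^ (8 * D\<^sup>2)"
      by (simp add: \<epsilon>_def m_eq flip: power_add mult.assoc)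
    also have "\<dots> \<le> 1 * \<theta> ^ (8 * D\<^sup>2)"
      by (rule mult_right_mono[OF theta_power_bound]) (use \<theta> in simp)
    finally show "(real m + 1) * \<epsilon> \<le> \<theta> ^ (8 * D\<^sup>2)" by simp
  qed simp
  also have "real D ^ m * real D ^ m = card (PiE (B \<union> B') (\<lambda>_. C))"
    using B by (simp add: card_PiE card_C card_Un_disjoint power_add)
  finally show ?thesis .
qed

text \<open>What is left for the colour of \<open>vw\<close> once the rows \<open>f u\<close> of all \<open>u \<in> A\<close> are revealed.\<close>
definition available :: "'u set \<Rightarrow> ('u \<Rightarrow> 'v \<Rightarrow> 'c) \<Rightarrow> 'v \<times> 'v \<Rightarrow> 'c set" where
  "available A f = (\<lambda>(v, w). {z. \<forall>u\<in>A. \<not> R (f u v) (f u w) z})"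

text \<open>
  The potential is the total size of the available sets, at most \<open>m\<^sup>2 D\<close>. A row that is not lazy lowers
  it by \<open>2 D m\<close>, so at least half of the \<open>m\<close> rows are lazy if the available sets are dense
  in the end.
\<close>
lemma dense_rows_count:
  assumes A: "finite A" "card A = m"
    and B: "finite B" "finite B'" "card B = m" "card B' = m" "B \<inter> B' = {}"
  shows "real (card {f \<in> PiE A (\<lambda>_. PiE (B \<union> B') (\<lambda>_. C)). dense_on B B' (available A f)})
         \<le> \<theta> ^ (256 * D ^ 4) * real (card (PiE (B \<union> B') (\<lambda>_. C))) ^ m"
proof -
  obtain us where us: "set us = A" "distinct us"
    using finite_distinct_list[OF A(1)] by blast
  define Rows where "Rows = PiE (B \<union> B') (\<lambda>_. C)"
  define upd where "upd u r W = (\<lambda>(v, w). {z \<in> W (v, w). \<not> R (r v) (r w) z})"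
    for u :: 'a and r :: "'b \<Rightarrow> 'c" and W
  define \<Phi> where "\<Phi> W = (\<Sum>p\<in>B \<times> B'. card (W p \<inter> C))" for W :: "'b \<times> 'b \<Rightarrow> 'c set"
  define \<delta> where "\<delta> = \<theta> ^ (8 * D\<^sup>2)"
  have \<delta>: "0 < \<delta>" "\<delta> \<le> 1" using \<theta> theta_le_1 by (simp_all add: \<delta>_def power_le_one)
  have fold_upd: "fold (\<lambda>u. upd u (f u)) vs W = (\<lambda>(v, w). W (v, w) \<inter> {z. \<forall>u\<in>set vs. \<not> R (f u v) (f u w) z})"
    for f vs W
    by (induction vs arbitrary: W) (auto simp: upd_def fun_eq_iff)
  have fold_eq: "fold (\<lambda>u. upd u (f u)) us (\<lambda>_. UNIV) = available A f" for f
    using us by (simp add: fold_upd available_def fun_eq_iff)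
  have "real (card {f \<in> PiE (set us) (\<lambda>_. Rows). dense_on B B' (fold (\<lambda>u. upd u (f u)) us (\<lambda>_. UNIV))})
      \<le> (\<Prod>u\<in>set us. 2 * \<delta>) / \<delta> ^ (64 * D\<^sup>2) * real (card Rows) ^ length us"
  proof (rule count_active_runs[where h = "2 * D * m" and \<Phi> = \<Phi>])
    fix u r W
    show "dense_on B B' W" if "dense_on B B' (upd u r W)"
    proof -
      have "card {p \<in> B \<times> B'. big (upd u r W p)} \<le> card {p \<in> B \<times> B'. big (W p)}"
      proof (rule card_mono)
        show "{p \<in> B \<times> B'. big (upd u r W p)} \<subseteq> {p \<in> B \<times> B'. big (W p)}"
          by (auto simp: upd_def elim!: big_mono)
      qed (use B in auto)
      then show ?thesis using that by (simp add: dense_on_def)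
    qed
    show "\<Phi> (upd u r W) \<le> \<Phi> W"
      unfolding \<Phi>_def
      by (rule sum_mono, rule card_mono) (use finite_C in \<open>auto simp: upd_def\<close>)
  next
    fix u W assume "dense_on B B' W"
    let ?rem = "\<lambda>r. {(v, w) \<in> B \<times> B'. \<exists>z\<in>W (v, w) \<inter> C. R (r v) (r w) z}"
    have drop: "\<Phi> (upd u r W) + card (?rem r) \<le> \<Phi> W" for r
    proof -
      have "(\<Sum>p\<in>B \<times> B'. if p \<in> ?rem r then 1 else 0) = card (?rem r)"
      proof -
        have "(B \<times> B') \<inter> ?rem r = ?rem r" by auto
        then show ?thesis using B by (simp only: sum.If_cases finite_cartesian_product) simp
      qed
      then have "\<Phi> (upd u r W) + card (?rem r)
          = (\<Sum>p\<in>B \<times> B'. card (upd u r W p \<inter> C) + (if p \<in> ?rem r then 1 else 0))"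
        by (simp only: \<Phi>_def sum.distrib)
      also have "\<dots> \<le> \<Phi> W" unfolding \<Phi>_def
      proof (rule sum_mono)
        fix p
        show "card (upd u r W p \<inter> C) + (if p \<in> ?rem r then 1 else 0) \<le> card (W p \<inter> C)"
        proof (cases "p \<in> ?rem r")
          case True
          then have "upd u r W p \<inter> C \<subset> W p \<inter> C" by (auto simp: upd_def)
          then have "card (upd u r W p \<inter> C) < card (W p \<inter> C)"
            by (intro psubset_card_mono) (use finite_C in auto)
          then show ?thesis using True by simp
        next
          case False
          have "card (upd u r W p \<inter> C) \<le> card (W p \<inter> C)"
            by (rule card_mono) (use finite_C in \<open>auto simp: upd_def\<close>)
          then show ?thesis using False by simp
        qed
      qed
      finally show ?thesis .
    qed
    have "card {r \<in> Rows. dense_on B B' (upd u r W) \<and> \<Phi> W < \<Phi> (upd u r W) + 2 * D * m}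
        \<le> card {r \<in> Rows. card (?rem r) < 2 * D * m}"
    proof (rule card_mono)
      show "finite {r \<in> Rows. card (?rem r) < 2 * D * m}"
        using B finite_C by (simp add: Rows_def finite_PiE)
      show "{r \<in> Rows. dense_on B B' (upd u r W) \<and> \<Phi> W < \<Phi> (upd u r W) + 2 * D * m}
          \<subseteq> {r \<in> Rows. card (?rem r) < 2 * D * m}"
      proof clarify
        fix r assume "\<Phi> W < \<Phi> (upd u r W) + 2 * D * m"
        then show "card (?rem r) < 2 * D * m" using drop[of r] by linarith
      qed
    qed
    then have "real (card {r \<in> Rows. dense_on B B' (upd u r W) \<and> \<Phi> W < \<Phi> (upd u r W) + 2 * D * m})
        \<le> real (card {r \<in> Rows. card (?rem r) < 2 * D * m})"
      by (rule of_nat_mono)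
    also have "\<dots> \<le> \<delta> * card Rows"
      unfolding Rows_def \<delta>_def by (rule lazy_rows_count[OF B \<open>dense_on B B' W\<close>])
    finally show "real (card {r \<in> Rows. dense_on B B' (upd u r W) \<and> \<Phi> W < \<Phi> (upd u r W) + 2 * D * m})
        \<le> \<delta> * card Rows" .
  next
    show "\<Phi> (\<lambda>_. UNIV) \<le> 2 * D * m * (64 * D\<^sup>2)"
      using B by (simp add: \<Phi>_def card_C m_eq card_cartesian_product)
  qed (use us \<delta> finite_C B D_pos m_pos in \<open>auto simp: Rows_def finite_PiE\<close>)
  also have "(\<Prod>u\<in>set us. 2 * \<delta>) / \<delta> ^ (64 * D\<^sup>2) * real (card Rows) ^ length us
      \<le> \<theta> ^ (256 * D ^ 4) * real (card Rows) ^ m"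
  proof -
    have "(\<Prod>u\<in>set us. 2 * \<delta>) / \<delta> ^ (64 * D\<^sup>2) = 2 ^ (128 * D\<^sup>2) * \<delta> ^ (64 * D\<^sup>2)"
    proof -
      have "(\<Prod>u\<in>set us. 2 * \<delta>) = 2 ^ (128 * D\<^sup>2) * \<delta> ^ (64 * D\<^sup>2 + 64 * D\<^sup>2)"
        using us A by (simp add: m_eq power_mult_distrib)
      then show ?thesis using \<delta> by (simp only: power_add) simp
    qed
    also have "\<dots> = 2 ^ (128 * D\<^sup>2) * \<theta> ^ (512 * D ^ 4)"
      by (simp add: \<delta>_def power4_eq_xxxx power2_eq_square mult.assoc flip: power_mult)
    also have "\<dots> \<le> 2 ^ (32 * (256 * D ^ 4)) * (\<theta> ^ (256 * D ^ 4) * \<theta> ^ (256 * D ^ 4))"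
    proof (rule mult_mono)
      have "D\<^sup>2 \<le> D ^ 4" using D_pos by (intro power_increasing) auto
      then show "(2::real) ^ (128 * D\<^sup>2) \<le> 2 ^ (32 * (256 * D ^ 4))"
        by (intro power_increasing) auto
      show "\<theta> ^ (512 * D ^ 4) \<le> \<theta> ^ (256 * D ^ 4) * \<theta> ^ (256 * D ^ 4)"
        by (simp flip: power_add)
    qed (use \<theta> in auto)
    also have "\<dots> = (2 ^ (32 * (256 * D ^ 4)) * \<theta> ^ (256 * D ^ 4)) * \<theta> ^ (256 * D ^ 4)"
      by simp
    also have "\<dots> \<le> 1 * \<theta> ^ (256 * D ^ 4)"
      by (rule mult_right_mono[OF theta_power_bound]) (use \<theta> in simp)
    finally have "(\<Prod>u\<in>set us. 2 * \<delta>) / \<delta> ^ (64 * D\<^sup>2) \<le> \<theta> ^ (256 * D ^ 4)" by simp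
    moreover have "length us = m" using us A distinct_card by metis
    ultimately show ?thesis by (simp only:) (intro mult_right_mono; simp)
  qed
  finally show ?thesis using us by (simp add: Rows_def fold_eq)
qed

text \<open>
  Either the rows of \<open>A\<close> leave a dense family of available sets, which is rare by
  \<open>dense_rows_count\<close>, or at least half of the \<open>m\<^sup>2\<close> pairs in \<open>B \<times> B'\<close> have to take their colours from
  sets of density at most \<open>\<theta>\<close>.
\<close>
lemma tripartite_independent_count:
  assumes "finite K"
    and A: "finite A" "card A = m"
    and B: "finite B" "finite B'" "card B = m" "card B' = m" "B \<inter> B' = {}"
    and K: "A \<times> (B \<union> B') \<subseteq> K" "B \<times> B' \<subseteq> K" and AB: "A \<inter> B = {}"
  shows "real (card {g \<in> PiE K (\<lambda>_. C). \<forall>u\<in>A. \<forall>v\<in>B. \<forall>w\<in>B'. \<not> R (g (u, v)) (g (u, w)) (g (v, w))})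
         \<le> 2 * \<theta> ^ (256 * D ^ 4) * real D ^ card K"
proof -
  define I where "I = A \<times> (B \<union> B')"
  define J where "J = K - I"
  have IJ: "finite I" "finite J" "I \<inter> J = {}" "I \<union> J = K"
    using assms by (auto simp: I_def J_def)
  have BJ: "B \<times> B' \<subseteq> J" using K AB by (auto simp: I_def J_def)
  (* The colours between A and B \<union> B' as a family of rows. *)
  define cur where "cur f = (\<lambda>u\<in>A. \<lambda>t\<in>B \<union> B'. f (u, t))" for f :: "'a \<times> 'a \<Rightarrow> 'c"
  define W where "W f = available A (cur f)" for f
  define F where "F = {f \<in> PiE I (\<lambda>_. C). dense_on B B' (W f)}"
  define Q where "Q f f' \<longleftrightarrow> (\<forall>p\<in>B \<times> B'. f' p \<in> W f p)" for f f'
  define \<eta> where "\<eta> = \<theta> ^ (256 * D ^ 4)"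
  have \<eta>: "\<eta> \<ge> 0" using \<theta> by (simp add: \<eta>_def)
  have cI: "card (PiE I (\<lambda>_. C)) = D ^ card I" and cJ: "card (PiE J (\<lambda>_. C)) = D ^ card J"
    using IJ by (simp_all add: card_PiE card_C)
  have finI: "finite (PiE I (\<lambda>_. C))" and finJ: "finite (PiE J (\<lambda>_. C))"
    using IJ finite_C by (simp_all add: finite_PiE)
  have cF: "real (card F) \<le> \<eta> * real D ^ card I"
  proof -
    let ?G = "{f \<in> PiE A (\<lambda>_. PiE (B \<union> B') (\<lambda>_. C)). dense_on B B' (available A f)}"
    have "card F \<le> card ?G"
    proof (rule card_inj_on_le)
      show "inj_on cur F"
      proof (rule inj_onI)
        fix f f' assume f: "f \<in> F" "f' \<in> F" and eq: "cur f = cur f'"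
        show "f = f'"
        proof (rule PiE_ext[of f I "\<lambda>_. C"])
          fix p assume "p \<in> I"
          then obtain u t where p: "p = (u, t)" "u \<in> A" "t \<in> B \<union> B'" by (auto simp: I_def)
          have "cur f u t = cur f' u t" using eq by simp
          then show "f p = f' p" using p by (simp add: cur_def)
        qed (use f in \<open>auto simp: F_def\<close>)
      qed
      show "cur ` F \<subseteq> ?G" by (auto simp: F_def cur_def W_def I_def PiE_iff)
      show "finite ?G" using A B finite_C by (simp add: finite_PiE)
    qed
    also have "real (card ?G) \<le> \<eta> * real (card (PiE (B \<union> B') (\<lambda>_. C))) ^ m"
      unfolding \<eta>_def by (rule dense_rows_count[OF A B])
    also have "\<dots> = \<eta> * real D ^ card I"
      using A B by (simp add: I_def card_PiE card_C card_cartesian_product power_mult mult.commute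
          flip: of_nat_power) (simp add: power_mult[symmetric] mult.commute)
    finally show ?thesis by simp
  qed
  have second: "real (card {f' \<in> PiE J (\<lambda>_. C). Q f f'})
      \<le> (if f \<in> F then real D ^ card J else 0) + \<eta> * real D ^ card J" if f: "f \<in> PiE I (\<lambda>_. C)" for f
  proof (cases "f \<in> F")
    case True
    have "card {f' \<in> PiE J (\<lambda>_. C). Q f f'} \<le> card (PiE J (\<lambda>_. C))"
      by (rule card_mono) (use finJ in auto)
    then have "real (card {f' \<in> PiE J (\<lambda>_. C). Q f f'}) \<le> real D ^ card J"
      unfolding cJ by (simp only: of_nat_le_iff flip: of_nat_power)
    then show ?thesis using True \<eta> by (simp add: add_increasing2)
  next
    case False
    let ?small = "{p \<in> B \<times> B'. \<not> big (W f p)}"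
    have "{f' \<in> PiE J (\<lambda>_. C). Q f f'} = PiE J (\<lambda>p. if p \<in> B \<times> B' then W f p \<inter> C else C)"
      using BJ by (auto simp: Q_def PiE_iff extensional_def split: if_splits)
    then have "real (card {f' \<in> PiE J (\<lambda>_. C). Q f f'})
        = (\<Prod>p\<in>J. real (card (if p \<in> B \<times> B' then W f p \<inter> C else C)))"
      using IJ by (simp add: card_PiE)
    also have "\<dots> \<le> (\<Prod>p\<in>J. (if p \<in> ?small then \<theta> else 1) * D)"
    proof (rule prod_mono, intro conjI)
      fix p
      have "card (W f p \<inter> C) \<le> D"
        unfolding card_C[symmetric] by (rule card_mono[OF finite_C]) simp
      then show "real (card (if p \<in> B \<times> B' then W f p \<inter> C else C)) \<le> (if p \<in> ?small then \<theta> else 1) * D"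
        by (auto simp: card_C big_def)
    qed simp
    also have "\<dots> = \<theta> ^ card ?small * real D ^ card J"
    proof -
      have "J \<inter> ?small = ?small" using BJ by auto
      then show ?thesis using IJ by (simp only: prod.distrib prod.If_cases prod_constant) simp
    qed
    also have "\<dots> \<le> \<eta> * real D ^ card J"
    proof (rule mult_right_mono)
      have "card {p \<in> B \<times> B'. big (W f p)} + card ?small = m\<^sup>2"
      proof -
        have "card ({p \<in> B \<times> B'. big (W f p)} \<union> ?small) = card (B \<times> B')"
          by (rule arg_cong[of _ _ card]) auto
        moreover have "card ({p \<in> B \<times> B'. big (W f p)} \<union> ?small)
            = card {p \<in> B \<times> B'. big (W f p)} + card ?small"
          by (rule card_Un_disjoint) (use B in auto)
        ultimately show ?thesis using B by (simp add: card_cartesian_product power2_eq_square)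
      qed
      moreover have "2 * card {p \<in> B \<times> B'. big (W f p)} \<le> m\<^sup>2"
        using False f by (auto simp: F_def dense_on_def)
      moreover have "m\<^sup>2 = 16384 * D ^ 4" by (simp add: m_eq power2_eq_square power4_eq_xxxx)
      ultimately have "256 * D ^ 4 \<le> card ?small" by linarith
      then show "\<theta> ^ card ?small \<le> \<eta>" unfolding \<eta>_def by (rule theta_power_antimono)
    qed simp
    finally show ?thesis using False by simp
  qed
  have sub: "{g \<in> PiE K (\<lambda>_. C). \<forall>u\<in>A. \<forall>v\<in>B. \<forall>w\<in>B'. \<not> R (g (u, v)) (g (u, w)) (g (v, w))}
      \<subseteq> {g \<in> PiE (I \<union> J) (\<lambda>_. C). Q (restrict g I) (restrict g J)}"
    using BJ unfolding IJ(4) by (auto simp: Q_def W_def available_def cur_def I_def)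
  have "real (card {g \<in> PiE K (\<lambda>_. C). \<forall>u\<in>A. \<forall>v\<in>B. \<forall>w\<in>B'. \<not> R (g (u, v)) (g (u, w)) (g (v, w))})
      \<le> real (card {g \<in> PiE (I \<union> J) (\<lambda>_. C). Q (restrict g I) (restrict g J)})"
    by (rule of_nat_mono, rule card_mono[OF _ sub], rule finite_subset[of _ "PiE (I \<union> J) (\<lambda>_. C)"])
      (use IJ finite_C in \<open>auto intro!: finite_PiE\<close>)
  also have "\<dots> \<le> real (\<Sum>f\<in>PiE I (\<lambda>_. C). card {f' \<in> PiE J (\<lambda>_. C). Q f f'})"
    by (rule of_nat_mono) (rule card_PiE_union_le[OF IJ(1-3) finite_C])
  also have "\<dots> \<le> (\<Sum>f\<in>PiE I (\<lambda>_. C). (if f \<in> F then real D ^ card J else 0) + \<eta> * real D ^ card J)"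
    unfolding of_nat_sum by (rule sum_mono) (rule second)
  also have "\<dots> = card F * real D ^ card J + real D ^ card I * (\<eta> * real D ^ card J)"
  proof -
    have "PiE I (\<lambda>_. C) \<inter> F = F" by (auto simp: F_def)
    then show ?thesis using finI cI by (simp add: sum.distrib sum.If_cases)
  qed
  also have "\<dots> \<le> \<eta> * real D ^ card I * real D ^ card J + real D ^ card I * (\<eta> * real D ^ card J)"
    by (intro add_right_mono mult_right_mono cF) simp
  also have "\<dots> = 2 * \<eta> * real D ^ (card I + card J)"
    by (simp add: power_add)
  also have "card I + card J = card K"
    using card_Un_disjoint[OF IJ(1-3)] IJ(4) by simp
  finally show ?thesis by (simp add: \<eta>_def)
qed

text \<open>
  The first moment method: a set of \<open>3 m\<close> vertices is split in increasing order into three thirds, and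
  the union bound runs over all such sets.
\<close>
lemma exists_colouring:
  fixes V :: "'v :: linorder set"
  assumes V: "finite V" and small: "2 * \<theta> ^ (256 * D ^ 4) * real (card V) ^ (3 * m) < 1"
  shows "\<exists>g. (\<forall>S\<subseteq>V. card S = 3 * m \<longrightarrow>
           (\<exists>a\<in>S. \<exists>b\<in>S. \<exists>c\<in>S. a < b \<and> b < c \<and> R (g (a, b)) (g (a, c)) (g (b, c))))"
proof -
  define K where "K = V \<times> V"
  define \<S> where "\<S> = {S. S \<subseteq> V \<and> card S = 3 * m}"
  define bad where "bad S = {g \<in> PiE K (\<lambda>_. C). \<forall>a\<in>S. \<forall>b\<in>S. \<forall>c\<in>S. a < b \<and> b < c \<longrightarrow>
      \<not> R (g (a, b)) (g (a, c)) (g (b, c))}" for S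
  have finK: "finite K" using V by (simp add: K_def)
  have finP: "finite (PiE K (\<lambda>_. C))" using finK finite_C by (simp add: finite_PiE)
  have fin\<S>: "finite \<S>" using V by (simp add: \<S>_def)
  have "card V choose (3 * m) \<le> card V ^ (3 * m)"
    by (cases "3 * m \<le> card V") (auto simp: binomial_le_pow binomial_eq_0)
  then have card\<S>: "card \<S> \<le> card V ^ (3 * m)"
    using n_subsets[OF V, of "3 * m"] by (simp add: \<S>_def)
  have card_bad: "real (card (bad S)) \<le> 2 * \<theta> ^ (256 * D ^ 4) * real D ^ card K" if S: "S \<in> \<S>" for S
  proof -
    have finS: "finite S" using S V finite_subset by (auto simp: \<S>_def)
    have cS: "card S = 3 * m" using S by (simp add: \<S>_def)
    obtain A where A: "A \<subseteq> S" "card A = m" "\<forall>a\<in>A. \<forall>b\<in>S - A. a < b"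
      using initial_segment_subset[OF finS, of m] cS by auto
    have "card (S - A) = 2 * m" using A cS finS finite_subset by (subst card_Diff_subset) auto
    then obtain B where B: "B \<subseteq> S - A" "card B = m" "\<forall>a\<in>B. \<forall>b\<in>S - A - B. a < b"
      using initial_segment_subset[of "S - A" m] finS by auto
    define B' where "B' = S - A - B"
    have cB': "card B' = m"
      using B \<open>card (S - A) = 2 * m\<close> finite_subset[OF B(1)] finS unfolding B'_def
      by (subst card_Diff_subset) auto
    have "bad S \<subseteq> {g \<in> PiE K (\<lambda>_. C). \<forall>u\<in>A. \<forall>v\<in>B. \<forall>w\<in>B'. \<not> R (g (u, v)) (g (u, w)) (g (v, w))}"
    proof (intro subsetI CollectI conjI ballI notI)
      fix g u v w
      assume g: "g \<in> bad S" and uvw: "u \<in> A" "v \<in> B" "w \<in> B'" and R: "R (g (u, v)) (g (u, w)) (g (v, w))"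
      have "u \<in> S" "v \<in> S" "w \<in> S" "u < v" "v < w" using uvw A B by (auto simp: B'_def)
      then show False using g R by (auto simp: bad_def)
    qed (auto simp: bad_def)
    then have "real (card (bad S))
        \<le> real (card {g \<in> PiE K (\<lambda>_. C). \<forall>u\<in>A. \<forall>v\<in>B. \<forall>w\<in>B'. \<not> R (g (u, v)) (g (u, w)) (g (v, w))})"
      by (intro of_nat_mono card_mono) (use finP in auto)
    also have "\<dots> \<le> 2 * \<theta> ^ (256 * D ^ 4) * real D ^ card K"
    proof (rule tripartite_independent_count)
      show "A \<times> (B \<union> B') \<subseteq> K" "B \<times> B' \<subseteq> K"
        using A B S by (auto simp: K_def \<S>_def B'_def)
    qed (use A B cB' finS finK in \<open>auto simp: B'_def intro: finite_subset\<close>)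
    finally show ?thesis .
  qed
  have "card (\<Union>S\<in>\<S>. bad S) \<le> (\<Sum>S\<in>\<S>. card (bad S))"
    by (rule card_UN_le[OF fin\<S>])
  then have "real (card (\<Union>S\<in>\<S>. bad S)) \<le> (\<Sum>S\<in>\<S>. real (card (bad S)))"
    by (simp only: of_nat_le_iff flip: of_nat_sum)
  also have "\<dots> \<le> (\<Sum>S\<in>\<S>. 2 * \<theta> ^ (256 * D ^ 4) * real D ^ card K)"
    by (rule sum_mono) (rule card_bad)
  also have "\<dots> = real (card \<S>) * (2 * \<theta> ^ (256 * D ^ 4) * real D ^ card K)" by simp
  also have "\<dots> \<le> real (card V) ^ (3 * m) * (2 * \<theta> ^ (256 * D ^ 4) * real D ^ card K)"
  proof (rule mult_right_mono)
    show "real (card \<S>) \<le> real (card V) ^ (3 * m)"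
      using card\<S> by (simp only: of_nat_le_iff flip: of_nat_power)
  qed (use \<theta> in simp)
  also have "\<dots> = (2 * \<theta> ^ (256 * D ^ 4) * real (card V) ^ (3 * m)) * real D ^ card K"
    by simp
  also have "\<dots> < 1 * real D ^ card K"
    by (rule mult_strict_right_mono[OF small]) (use D_pos in simp)
  also have "\<dots> = real (card (PiE K (\<lambda>_. C)))"
    using finK by (simp add: card_PiE card_C)
  finally have "card (\<Union>S\<in>\<S>. bad S) < card (PiE K (\<lambda>_. C))" by simp
  then have "\<not> PiE K (\<lambda>_. C) \<subseteq> (\<Union>S\<in>\<S>. bad S)"
    using card_mono[of "\<Union>S\<in>\<S>. bad S" "PiE K (\<lambda>_. C)"] finP fin\<S> by (auto simp: bad_def)
  then obtain g where "g \<in> PiE K (\<lambda>_. C)" "\<forall>S\<in>\<S>. g \<notin> bad S" by auto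
  then show ?thesis by (intro exI[of _ g]) (auto simp: bad_def \<S>_def)
qed

end

section \<open>Triangles that are cyclic in many tournaments\<close>

text \<open>
  The colour of a pair \<open>a < b\<close> lists for each of \<open>d\<close> tournaments whether the pair is oriented upwards.
  For colours \<open>x, y, z\<close> of the pairs \<open>ab, ac, bc\<close> with \<open>a < b < c\<close>, the triangle is cyclic in the \<open>i\<close>-th
  tournament if \<open>ab\<close> and \<open>bc\<close> have the same orientation and \<open>ac\<close> has the opposite one.
\<close>
definition cyclic_count :: "nat \<Rightarrow> bool list \<Rightarrow> bool list \<Rightarrow> bool list \<Rightarrow> nat" where
  "cyclic_count d x y z = (\<Sum>i<d. of_bool (x ! i = z ! i \<and> x ! i \<noteq> y ! i))"

text \<open>Holds in each tournament separately, since four of its vertices span at most two cyclic triangles.\<close>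
lemma cyclic_count_four_vertices:
  "cyclic_count d ab ac bc + cyclic_count d ab ae be + cyclic_count d ac ae ce + cyclic_count d bc be ce \<le> 2 * d"
proof -
  have "cyclic_count d ab ac bc + cyclic_count d ab ae be + cyclic_count d ac ae ce + cyclic_count d bc be ce
      = (\<Sum>i<d. of_bool (ab ! i = bc ! i \<and> ab ! i \<noteq> ac ! i) + of_bool (ab ! i = be ! i \<and> ab ! i \<noteq> ae ! i)
          + of_bool (ac ! i = ce ! i \<and> ac ! i \<noteq> ae ! i) + of_bool (bc ! i = ce ! i \<and> bc ! i \<noteq> be ! i))"
    by (simp only: cyclic_count_def sum.distrib)
  also have "\<dots> \<le> (\<Sum>i<d. 2)"
  proof (rule sum_mono)
    fix i
    show "of_bool (ab ! i = bc ! i \<and> ab ! i \<noteq> ac ! i) + of_bool (ab ! i = be ! i \<and> ab ! i \<noteq> ae ! i)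
          + of_bool (ac ! i = ce ! i \<and> ac ! i \<noteq> ae ! i) + of_bool (bc ! i = ce ! i \<and> bc ! i \<noteq> be ! i) \<le> (2 :: nat)"
      by (cases "ab ! i"; cases "ac ! i"; cases "bc ! i"; cases "ae ! i"; cases "be ! i"; cases "ce ! i") simp_all
  qed
  finally show ?thesis by simp
qed

lemma cyclic_count_hdist:
  assumes "y \<in> cube d"
  shows "d \<le> cyclic_count d x y z + hdist d x z + hdist d x (map Not y)"
proof -
  have "d = (\<Sum>i<d. 1)" by simp
  also have "\<dots> \<le> (\<Sum>i<d. of_bool (x ! i = z ! i \<and> x ! i \<noteq> y ! i) + of_bool (x ! i \<noteq> z ! i)
      + of_bool (x ! i \<noteq> map Not y ! i))"
    using assms by (intro sum_mono) (auto simp: cube_def)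
  also have "\<dots> = cyclic_count d x y z + hdist d x z + hdist d x (map Not y)"
    by (simp only: cyclic_count_def hdist_def sum.distrib)
  finally show ?thesis .
qed

text \<open>
  Since \<open>\<theta> = 2 ^ (-j)\<close>, fewer than \<open>\<theta> D / 2\<close> points are far from \<open>Z\<close>, and likewise for the complements
  of the points in \<open>Y\<close>. So \<open>X\<close> contains a point that is at distance less than \<open>14 j\<close> from both, and
  fewer than \<open>28 j\<close> of the \<open>84 j\<close> coordinates are lost.
\<close>
lemma cyclic_count_hits_boxes:
  assumes j: "j > 0"
    and XYZ: "X \<subseteq> cube (84 * j)" "Y \<subseteq> cube (84 * j)" "Z \<subseteq> cube (84 * j)"
    and big: "(1/2) ^ j * real (2 ^ (84 * j)) < card X" "(1/2) ^ j * real (2 ^ (84 * j)) < card Y"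
      "(1/2) ^ j * real (2 ^ (84 * j)) < card Z"
  shows "\<exists>x\<in>X. \<exists>y\<in>Y. \<exists>z\<in>Z. 56 * j < cyclic_count (84 * j) x y z"
proof -
  define D where "D = (2::real) ^ (84 * j)"
  have D: "D > 0" by (simp add: D_def)
  define far where "far A = {x \<in> cube (84 * j). \<forall>a\<in>A. hdist (84 * j) x a \<ge> 14 * j}" for A
  have far: "real (card (far A)) < (1/2) ^ j * D / 2"
    if A: "A \<subseteq> cube (84 * j)" "(1/2) ^ j * D < card A" for A
  proof (rule ccontr)
    assume "\<not> ?thesis"
    then have "((1/2) ^ j * D / 2) * ((1/2) ^ j * D) < real (card (far A)) * card A"
      using A D by (intro mult_le_less_imp_less) auto
    also have "\<dots> \<le> D\<^sup>2 / 8 ^ j"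
      unfolding far_def D_def by (rule far_points_bound[OF A(1)])
    finally have "((1/2) ^ j * (1/2) ^ j / 2) * D\<^sup>2 < (1 / 8 ^ j) * D\<^sup>2"
      by (simp add: power2_eq_square mult_ac)
    then have "(1/2) ^ j * (1/2) ^ j / 2 < 1 / (8 ^ j :: real)"
      using D by (simp only: mult_less_cancel_right_pos zero_less_power)
    moreover have "1 / (8 ^ j :: real) = (1/2) ^ j * (1/2) ^ j * (1/2) ^ j"
      by (simp flip: power_mult_distrib add: power_one_over)
    moreover have "(1/2 :: real) ^ j \<le> 1/2"
      using power_decreasing[of 1 j "1/2 :: real"] j by simp
    then have "(1/2) ^ j * (1/2) ^ j * (1/2) ^ j \<le> (1/2) ^ j * (1/2) ^ j * (1/2 :: real)"
      by (intro mult_left_mono) auto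
    ultimately show False by simp
  qed
  have Y': "map Not ` Y \<subseteq> cube (84 * j)" using XYZ by (auto simp: cube_def)
  have "inj (map Not)" by (rule inj_mapI) (simp add: inj_def)
  then have "inj_on (map Not) Y" by (rule inj_on_subset) simp
  then have "card (map Not ` Y) = card Y" by (rule card_image)
  then have "real (card (far (map Not ` Y))) + real (card (far Z)) < card X"
    using far[OF Y'] far[OF XYZ(3)] big unfolding D_def by simp
  then have "card (far (map Not ` Y) \<union> far Z) < card X"
    using card_Un_le[of "far (map Not ` Y)" "far Z"] by linarith
  moreover have "finite (far (map Not ` Y) \<union> far Z)"
    by (simp add: far_def finite_cube)
  ultimately have "\<not> X \<subseteq> far (map Not ` Y) \<union> far Z"
    using card_mono[of "far (map Not ` Y) \<union> far Z" X] by linarith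
  then obtain x where x: "x \<in> X" "x \<notin> far (map Not ` Y)" "x \<notin> far Z" by auto
  then obtain y where "y \<in> Y" "hdist (84 * j) x (map Not y) < 14 * j"
    using XYZ(1) by (auto simp: far_def not_le)
  moreover obtain z where "z \<in> Z" "hdist (84 * j) x z < 14 * j"
    using x XYZ(1) by (auto simp: far_def not_le)
  moreover have "y \<in> cube (84 * j)" using XYZ(2) \<open>y \<in> Y\<close> by auto
  ultimately show ?thesis
    using cyclic_count_hdist[of y "84 * j" x z] x(1) j by (intro bexI[of _ x] bexI[of _ y] bexI[of _ z]) linarith+
qed

text \<open>
  The union bound works up to \<open>M ^ (384 D\<^sup>2) < \<theta> ^ (-256 D ^ 4) / 2\<close>, where \<open>\<theta> = 2 ^ (-j)\<close>. The value
  \<open>M = 2 ^ (j D\<^sup>2 / 2)\<close>, with \<open>D\<^sup>2 = 2 ^ (168 j)\<close>, satisfies this. For \<open>k = 384 D\<^sup>2\<close> this means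
  \<open>log M\<close> is of order \<open>k log k\<close>.
\<close>
theorem sparse_hypergraph_small_independence:
  fixes j :: nat
  assumes j: "j \<ge> 32"
  defines "D \<equiv> 2 ^ (84 * j) :: nat"
  shows "\<exists>h :: nat \<Rightarrow> nat \<Rightarrow> nat \<Rightarrow> bool.
    (\<forall>a b c e. of_bool (h a b c) + of_bool (h a b e) + of_bool (h a c e) + of_bool (h b c e) \<le> (2::nat)) \<and>
    (\<forall>S \<subseteq> {1..2 ^ (j * 2 ^ (168 * j - 1))}. card S = 384 * D\<^sup>2 \<longrightarrow>
       (\<exists>a\<in>S. \<exists>b\<in>S. \<exists>c\<in>S. a < b \<and> b < c \<and> h a b c))"
proof -
  define V where "V = {1..(2::nat) ^ (j * 2 ^ (168 * j - 1))}"
  interpret box_hitting "cube (84 * j)" "\<lambda>x y z. 56 * j < cyclic_count (84 * j) x y z" "(1/2) ^ j" D "128 * D\<^sup>2"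
  proof
    show "(1/2 :: real) ^ j \<le> 1 / 2 ^ 32"
      using power_decreasing[of 32 j "1/2 :: real"] j by (simp add: power_one_over)
    show "\<exists>x\<in>X. \<exists>y\<in>Y. \<exists>z\<in>Z. 56 * j < cyclic_count (84 * j) x y z"
      if "X \<subseteq> cube (84 * j)" "Y \<subseteq> cube (84 * j)" "Z \<subseteq> cube (84 * j)"
        "(1/2) ^ j * real D < card X" "(1/2) ^ j * real D < card Y" "(1/2) ^ j * real D < card Z"
      for X Y Z
      by (rule cyclic_count_hits_boxes) (use j that in \<open>auto simp: D_def\<close>)
  qed (auto simp: finite_cube card_cube D_def)
  have "\<exists>g. (\<forall>S\<subseteq>V. card S = 3 * (128 * D\<^sup>2) \<longrightarrow>
      (\<exists>a\<in>S. \<exists>b\<in>S. \<exists>c\<in>S. a < b \<and> b < c \<and> 56 * j < cyclic_count (84 * j) (g (a, b)) (g (a, c)) (g (b, c))))"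
  proof (rule exists_colouring)
    show "2 * ((1/2) ^ j) ^ (256 * D ^ 4) * real (card V) ^ (3 * (128 * D\<^sup>2)) < 1"
    proof -
      have D2: "D\<^sup>2 = 2 * 2 ^ (168 * j - 1)"
      proof -
        have "D\<^sup>2 = 2 ^ (168 * j)" by (simp add: D_def flip: power_mult)
        also have "168 * j = Suc (168 * j - 1)" using j by simp
        finally show ?thesis by simp
      qed
      have D4: "D ^ 4 = D\<^sup>2 * D\<^sup>2" by (simp add: power4_eq_xxxx power2_eq_square)
      define E where "E = j * (2 ^ (168 * j - 1) * D\<^sup>2)"
      have E: "E > 0" using j D_pos by (simp add: E_def)
      have "real (card V) ^ (3 * (128 * D\<^sup>2)) = 2 ^ (384 * E)"
        by (simp add: V_def E_def mult_ac flip: power_mult)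
      moreover have "((1/2 :: real) ^ j) ^ (256 * D ^ 4) = 1 / 2 ^ (512 * E)"
        unfolding D4 using D2 by (simp add: E_def power_one_over mult_ac flip: power_mult)
      moreover have "2 * (2::real) ^ (384 * E) < 2 ^ (512 * E)"
      proof -
        have "2 * (2::real) ^ (384 * E) = 2 ^ (Suc (384 * E))" by simp
        also have "\<dots> < 2 ^ (512 * E)" by (rule power_strict_increasing) (use E in auto)
        finally show ?thesis .
      qed
      ultimately show ?thesis by (simp add: field_simps)
    qed
  qed (simp add: V_def)
  then obtain g where g: "\<forall>S\<subseteq>V. card S = 384 * D\<^sup>2 \<longrightarrow>
      (\<exists>a\<in>S. \<exists>b\<in>S. \<exists>c\<in>S. a < b \<and> b < c \<and> 56 * j < cyclic_count (84 * j) (g (a, b)) (g (a, c)) (g (b, c)))"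
    by auto
  define h where "h a b c \<longleftrightarrow> 56 * j < cyclic_count (84 * j) (g (a, b)) (g (a, c)) (g (b, c))" for a b c
  have "of_bool (h a b c) + of_bool (h a b e) + of_bool (h a c e) + of_bool (h b c e) \<le> (2::nat)" for a b c e
  proof -
    define p1 p2 p3 p4 where
      "p1 = cyclic_count (84 * j) (g (a, b)) (g (a, c)) (g (b, c))"
      and "p2 = cyclic_count (84 * j) (g (a, b)) (g (a, e)) (g (b, e))"
      and "p3 = cyclic_count (84 * j) (g (a, c)) (g (a, e)) (g (c, e))"
      and "p4 = cyclic_count (84 * j) (g (b, c)) (g (b, e)) (g (c, e))"
    have "p1 + p2 + p3 + p4 \<le> 168 * j"
      using cyclic_count_four_vertices[of "84 * j" "g (a, b)" "g (a, c)" "g (b, c)" "g (a, e)" "g (b, e)" "g (c, e)"]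
      by (simp add: p1_def p2_def p3_def p4_def)
    moreover have "h a b c \<longleftrightarrow> 56 * j < p1" "h a b e \<longleftrightarrow> 56 * j < p2"
        "h a c e \<longleftrightarrow> 56 * j < p3" "h b c e \<longleftrightarrow> 56 * j < p4"
      by (simp_all add: h_def p1_def p2_def p3_def p4_def)
    ultimately show ?thesis by (auto simp: of_bool_def)
  qed
  moreover have "\<forall>S \<subseteq> V. card S = 384 * D\<^sup>2 \<longrightarrow> (\<exists>a\<in>S. \<exists>b\<in>S. \<exists>c\<in>S. a < b \<and> b < c \<and> h a b c)"
    using g by (simp add: h_def)
  ultimately show ?thesis unfolding V_def by blast
qed

section \<open>Stepping up\<close>

text \<open>
  Numbers below \<open>2 ^ N\<close> are the leaves of a complete binary tree, and \<open>u div 2 ^ i\<close> is the ancestor of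
  \<open>u\<close> at height \<open>i\<close>. So \<open>level u v\<close> is the height of the lowest common ancestor.
\<close>
definition level :: "nat \<Rightarrow> nat \<Rightarrow> nat" where
  "level u v = (LEAST i. u div 2 ^ i = v div 2 ^ i)"

lemma ex_level: "\<exists>i. u div 2 ^ i = v div (2::nat) ^ i"
proof
  have "u < 2 ^ (u + v)" "v < 2 ^ (u + v)"
    by (rule le_less_trans[OF _ less_exp], simp)+
  then show "u div 2 ^ (u + v) = v div 2 ^ (u + v)" by simp
qed

lemma level_le_iff: "level u v \<le> i \<longleftrightarrow> u div 2 ^ i = v div 2 ^ i"
proof
  have "u div 2 ^ level u v = v div 2 ^ level u v"
    unfolding level_def by (rule LeastI_ex[OF ex_level])
  moreover assume "level u v \<le> i"
  then have "(2::nat) ^ i = 2 ^ level u v * 2 ^ (i - level u v)" by (simp flip: power_add)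
  ultimately show "u div 2 ^ i = v div 2 ^ i" by (simp add: div_mult2_eq)
next
  assume "u div 2 ^ i = v div 2 ^ i"
  then show "level u v \<le> i" unfolding level_def by (rule Least_le)
qed

lemma level_pos: "u \<noteq> v \<Longrightarrow> 0 < level u v"
  using level_le_iff[of u v 0] by simp

lemma level_bound: "u < 2 ^ N \<Longrightarrow> v < 2 ^ N \<Longrightarrow> level u v \<le> N"
  by (simp add: level_le_iff)

lemma level_max:
  assumes "u < v" "v < w"
  shows "level u w = max (level u v) (level v w)"
proof -
  have "level u w \<le> i \<longleftrightarrow> max (level u v) (level v w) \<le> i" for i
  proof -
    have "u div 2 ^ i \<le> v div 2 ^ i" "v div 2 ^ i \<le> w div 2 ^ i"
      using assms by (simp_all add: div_le_mono)
    then show ?thesis by (auto simp: level_le_iff)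
  qed
  then show ?thesis by (metis order_antisym order_refl)
qed

text \<open>The tree is binary: three leaves cannot all be separated at the same vertex.\<close>
lemma level_neq:
  assumes "u < v" "v < w"
  shows "level u v \<noteq> level v w"
proof
  assume eq: "level u v = level v w"
  obtain i where i: "level u v = Suc i"
    using level_pos[of u v] assms by (cases "level u v") auto
  have "u div 2 ^ i < v div 2 ^ i" "v div 2 ^ i < w div 2 ^ i"
    using level_le_iff[of u v i] level_le_iff[of v w i] i eq assms
      div_le_mono[of u v "2 ^ i"] div_le_mono[of v w "2 ^ i"] by auto
  moreover have "u div 2 ^ i div 2 = w div 2 ^ i div 2"
    using level_le_iff[of u v "Suc i"] level_le_iff[of v w "Suc i"] i eq
    by (simp add: mult.commute flip: div_mult2_eq)
  ultimately show False by linarith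
qed

text \<open>
  A decreasing comb is a sequence \<open>v\<^sub>1 < \<dots> < v\<^sub>k < w\<close> for which the levels of consecutive elements
  decrease. It is indexed by its set \<open>S\<close> of levels, where \<open>f a\<close> is the element that has level
  \<open>a\<close> with its successor; then \<open>a\<close> is also the level of \<open>f a\<close> and any later element. An increasing
  comb is the mirror image, with \<open>w\<close> as its first element.
\<close>
definition dec_comb :: "nat set \<Rightarrow> nat set \<Rightarrow> (nat \<Rightarrow> nat) \<Rightarrow> nat \<Rightarrow> bool" where
  "dec_comb T S f w \<longleftrightarrow> w \<in> T \<and> f ` S \<subseteq> T \<and> (\<forall>a\<in>S. f a < w \<and> level (f a) w = a) \<and>
     (\<forall>a\<in>S. \<forall>b\<in>S. a < b \<longrightarrow> f b < f a \<and> level (f b) (f a) = b)"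

definition inc_comb :: "nat set \<Rightarrow> nat set \<Rightarrow> (nat \<Rightarrow> nat) \<Rightarrow> nat \<Rightarrow> bool" where
  "inc_comb T S f w \<longleftrightarrow> w \<in> T \<and> f ` S \<subseteq> T \<and> (\<forall>a\<in>S. w < f a \<and> level w (f a) = a) \<and>
     (\<forall>a\<in>S. \<forall>b\<in>S. a < b \<longrightarrow> f a < f b \<and> level (f a) (f b) = b)"

text \<open>
  At the root of the subtree spanned by \<open>T\<close>, one of the two halves contains at least half of the
  leaves. A decreasing comb in the upper half is extended by any leaf of the lower half, and an
  increasing comb in the lower half by any leaf of the upper one.
\<close>
lemma comb_exists:
  assumes "finite T" "2 ^ (p + q) \<le> card T"
  shows "(\<exists>S f w. finite S \<and> card S = p \<and> dec_comb T S f w) \<or> (\<exists>S f w. finite S \<and> card S = q \<and> inc_comb T S f w)"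
  using assms
proof (induction "p + q" arbitrary: T p q)
  case (Suc k)
  have ne: "T \<noteq> {}" using Suc.prems by auto
  show ?case
  proof (cases "p = 0 \<or> q = 0")
    case True
    obtain w where "w \<in> T" using ne by auto
    then have "dec_comb T {} f w" "inc_comb T {} f w" for f by (auto simp: dec_comb_def inc_comb_def)
    then show ?thesis using True by (metis card.empty finite.emptyI)
  next
    case False
    define lo hi where "lo = Min T" and "hi = Max T"
    have lohi: "lo \<in> T" "hi \<in> T" "\<And>x. x \<in> T \<Longrightarrow> lo \<le> x \<and> x \<le> hi"
      using ne Suc.prems(1) by (auto simp: lo_def hi_def)
    have "2 ^ 1 \<le> (2::nat) ^ (p + q)" using False by (intro power_increasing) auto
    then have "1 < card T" using Suc.prems(2) by simp
    then have "lo \<noteq> hi"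
      by (metis One_nat_def card_le_Suc0_iff_eq dual_order.antisym leD Suc.prems(1) lohi(3))
    then have "lo < hi" using lohi(3)[OF lohi(1)] by simp
    define r where "r = level lo hi"
    (* The two halves below the root r of the subtree: T0 contains lo, and T1 contains hi. *)
    define T0 where "T0 = {x \<in> T. level lo x < r}"
    define T1 where "T1 = {x \<in> T. \<not> level lo x < r}"
    have sep: "x < y \<and> level x y = r" if "x \<in> T0" "y \<in> T1" for x y
    proof -
      have x: "level lo x < r" "lo \<le> x" and y: "\<not> level lo y < r" "y \<le> hi" "lo \<le> y"
        using that lohi by (auto simp: T0_def T1_def)
      have lo: "level lo lo = 0" using level_le_iff[of lo lo 0] by simp
      have "lo < y" using y lo \<open>lo < hi\<close> level_pos[of lo hi] by (cases "lo = y") (auto simp: r_def)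
      have ly: "level lo y = r"
        using y level_max[of lo y hi] \<open>lo < y\<close> by (cases "y = hi") (auto simp: r_def)
      have "x < y"
      proof (rule ccontr)
        assume "\<not> x < y"
        then have "level lo y \<le> level lo x" using level_max[of lo y x] \<open>lo < y\<close> by (cases "x = y") auto
        then show False using x ly by simp
      qed
      moreover have "level x y = r"
        using level_max[of lo x y] \<open>x < y\<close> x ly by (cases "x = lo") auto
      ultimately show ?thesis by simp
    qed
    have small0: "level x y < r" if "x \<in> T0" "y \<in> T0" "x < y" for x y
      using that level_max[of lo x y] lohi(3)[of x] by (cases "x = lo") (auto simp: T0_def)
    have small1: "level x y < r" if xy: "x \<in> T1" "y \<in> T1" "x < y" for x y
    proof -
      have lo0: "lo \<in> T0"
        using lohi level_le_iff[of lo lo 0] level_pos[of lo hi] \<open>lo < hi\<close> by (simp add: T0_def r_def)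
      then have "lo < x" "level lo x = r" "level lo y = r" using sep xy by auto
      then show ?thesis using level_max[of lo x y] level_neq[of lo x y] xy by simp
    qed
    have T: "T = T0 \<union> T1" "T0 \<inter> T1 = {}" "finite T0" "finite T1"
      using Suc.prems(1) by (auto simp: T0_def T1_def)
    have "card T0 + card T1 = card T" using T by (simp add: card_Un_disjoint)
    moreover have "(2::nat) ^ (p + q) = 2 ^ k + 2 ^ k" using Suc.hyps(2)[symmetric] by simp
    ultimately consider "2 ^ k \<le> card T0" | "2 ^ k \<le> card T1" using Suc.prems(2) by linarith
    then show ?thesis
    proof cases
      case 1
      have "k = p + (q - 1)" using False Suc.hyps(2) by simp
      then consider S f w where "finite S" "card S = p" "dec_comb T0 S f w"
        | S f w where "finite S" "card S = q - 1" "inc_comb T0 S f w"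
        using Suc.hyps(1)[of p "q - 1" T0] 1 T by auto
      then show ?thesis
      proof cases
        case 1
        then have "dec_comb T S f w" using T by (auto simp: dec_comb_def)
        then show ?thesis using 1 by blast
      next
        case 2
        have le: "a < r" if "a \<in> S" for a
          using 2(3) that small0[of w "f a"] by (auto simp: inc_comb_def)
        then have rS: "r \<notin> S" by auto
        have hi1: "hi \<in> T1" using lohi by (simp add: T1_def r_def)
        have "inc_comb T (insert r S) (f(r := hi)) w"
          using 2(3) le rS sep[OF _ hi1] T lohi
          unfolding inc_comb_def by (auto simp: image_subset_iff dest: less_asym)
        moreover have "card (insert r S) = q" using 2 rS False by simp
        ultimately show ?thesis using 2(1) by blast
      qed
    next
      case 2
      have "k = (p - 1) + q" using False Suc.hyps(2) by simp
      then consider S f w where "finite S" "card S = p - 1" "dec_comb T1 S f w"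
        | S f w where "finite S" "card S = q" "inc_comb T1 S f w"
        using Suc.hyps(1)[of "p - 1" q T1] 2 T by auto
      then show ?thesis
      proof cases
        case 2
        then have "inc_comb T S f w" using T by (auto simp: inc_comb_def)
        then show ?thesis using 2 by blast
      next
        case 1
        have le: "a < r" if "a \<in> S" for a
          using 1(3) that small1[of "f a" w] by (auto simp: dec_comb_def)
        then have rS: "r \<notin> S" by auto
        have lo0: "lo \<in> T0"
          using lohi level_le_iff[of lo lo 0] level_pos[of lo hi] \<open>lo < hi\<close> by (simp add: T0_def r_def)
        have "dec_comb T (insert r S) (f(r := lo)) w"
          using 1(3) le rS sep[OF lo0] T lohi
          unfolding dec_comb_def by (auto simp: image_subset_iff dest: less_asym)
        moreover have "card (insert r S) = p" using 1 rS False by simp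
        ultimately show ?thesis using 1(1) by blast
      qed
    qed
  qed
next
  case 0
  then obtain w where "w \<in> T" by fastforce
  then have "dec_comb T {} f w" for f by (auto simp: dec_comb_def)
  then show ?case using 0 by (metis add_is_0 card.empty finite.emptyI)
qed

definition red4 :: "(nat \<Rightarrow> nat \<Rightarrow> nat \<Rightarrow> bool) \<Rightarrow> nat \<Rightarrow> nat \<Rightarrow> nat \<Rightarrow> nat \<Rightarrow> bool" where
  "red4 h v1 v2 v3 v4 \<longleftrightarrow> (let a = level v1 v2; b = level v2 v3; c = level v3 v4 in
     (a < b \<and> b < c \<and> h a b c) \<or> (c < b \<and> b < a \<and> h c b a))"

text \<open>
  With \<open>a, b, c, e\<close> the four consecutive levels, the five 4-subsets have the levels \<open>bce\<close>,
  \<open>max(a,b)ce\<close>, \<open>a max(b,c) e\<close>, \<open>ab max(c,e)\<close> and \<open>abc\<close>. If the levels are monotone, two of these triples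
  coincide, and among the four different ones at most two are edges. If they are not monotone, at
  least two of the five triples fail to be monotone.
\<close>
lemma red4_five:
  assumes h: "\<And>a b c e. of_bool (h a b c) + of_bool (h a b e) + of_bool (h a c e) + of_bool (h b c e) \<le> (2::nat)"
    and v: "v1 < v2" "v2 < v3" "v3 < v4" "v4 < v5"
  shows "of_bool (red4 h v2 v3 v4 v5) + of_bool (red4 h v1 v3 v4 v5) + of_bool (red4 h v1 v2 v4 v5)
       + of_bool (red4 h v1 v2 v3 v5) + of_bool (red4 h v1 v2 v3 v4) \<le> (3::nat)"
proof -
  define a b c e where "a = level v1 v2" and "b = level v2 v3" and "c = level v3 v4" and "e = level v4 v5"
  have neq: "a \<noteq> b" "b \<noteq> c" "c \<noteq> e"
    using level_neq v by (simp_all add: a_def b_def c_def e_def)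
  have mx: "level v1 v3 = max a b" "level v2 v4 = max b c" "level v3 v5 = max c e"
    using level_max v by (simp_all add: a_def b_def c_def e_def)
  define P where "P x y z \<longleftrightarrow> (x < y \<and> y < z \<and> h x y z) \<or> (z < y \<and> y < x \<and> h z y x)" for x y z
  have r: "red4 h v2 v3 v4 v5 \<longleftrightarrow> P b c e" "red4 h v1 v3 v4 v5 \<longleftrightarrow> P (max a b) c e"
     "red4 h v1 v2 v4 v5 \<longleftrightarrow> P a (max b c) e" "red4 h v1 v2 v3 v5 \<longleftrightarrow> P a b (max c e)"
     "red4 h v1 v2 v3 v4 \<longleftrightarrow> P a b c"
    by (simp_all add: red4_def P_def Let_def mx flip: a_def b_def c_def e_def)
  have up: "of_bool (h a b c) + of_bool (h a b e) + of_bool (h a c e) + of_bool (h b c e) \<le> (2::nat)"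
    and down: "of_bool (h e c b) + of_bool (h e c a) + of_bool (h e b a) + of_bool (h c b a) \<le> (2::nat)"
    using h by blast+
  consider "a < b \<and> b < c \<and> c < e" | "e < c \<and> c < b \<and> b < a" | "\<not> (a < b \<and> b < c \<and> c < e)" "\<not> (e < c \<and> c < b \<and> b < a)"
    by blast
  then show ?thesis
  proof cases
    case 1
    then have "P b c e = h b c e" "P (max a b) c e = h b c e" "P a (max b c) e = h a c e"
      "P a b (max c e) = h a b e" "P a b c = h a b c" by (auto simp: P_def max_def)
    then show ?thesis unfolding r using up by (auto simp: of_bool_def split: if_splits)
  next
    case 2
    then have "P b c e = h e c b" "P (max a b) c e = h e c a" "P a (max b c) e = h e b a"
      "P a b (max c e) = h c b a" "P a b c = h c b a" by (auto simp: P_def max_def)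
    then show ?thesis unfolding r using down by (auto simp: of_bool_def split: if_splits)
  next
    case 3
    have "\<not> P b c e \<or> \<not> P a b c" using 3 by (auto simp: P_def)
    moreover have "\<not> P a b c \<or> \<not> P (max a b) c e \<or> \<not> P a (max b c) e"
      using 3 neq by (auto simp: P_def max_def split: if_splits)
    moreover have "\<not> P b c e \<or> \<not> P a b (max c e) \<or> \<not> P a (max b c) e"
      using 3 neq by (auto simp: P_def max_def split: if_splits)
    ultimately show ?thesis unfolding r by (auto simp: of_bool_def)
  qed
qed

lemma obtain_increasing_five:
  fixes S :: "nat set"
  assumes "finite S" "card S = 5"
  obtains a b c d e where "S = {a, b, c, d, e}" "a < b" "b < c" "c < d" "d < e"
proof -
  define l where "l = sorted_list_of_set S"
  have l: "length l = Suc (Suc (Suc (Suc (Suc 0))))" "set l = S" "strict_sorted l"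
    using assms by (simp_all add: l_def)
  from l(1) obtain a b c d e where "l = [a, b, c, d, e]" by (auto simp: length_Suc_conv)
  then show ?thesis using that[of a b c d e] l by auto
qed

definition red_edge :: "(nat \<Rightarrow> nat \<Rightarrow> nat \<Rightarrow> bool) \<Rightarrow> nat set \<Rightarrow> bool" where
  "red_edge h X \<longleftrightarrow> (let l = sorted_list_of_set X in red4 h (l ! 0) (l ! 1) (l ! 2) (l ! 3))"

lemma red_edge_iff:
  assumes "a < b" "b < c" "c < d"
  shows "red_edge h {a, b, c, d} \<longleftrightarrow> red4 h a b c d"
proof -
  have "sorted_list_of_set (set [a, b, c, d]) = [a, b, c, d]"
    by (rule sorted_list_of_set.idem_if_sorted_distinct) (use assms in auto)
  then show ?thesis by (simp add: red_edge_def Let_def numeral_3_eq_3 numeral_2_eq_2)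
qed

text \<open>
  A set of \<open>2 ^ (2 q)\<close> leaves contains a comb with \<open>q\<close> levels in one of the two directions. Any
  three of its levels are the consecutive levels of four of its leaves.
\<close>
lemma stepping_up:
  assumes h: "\<And>a b c e. of_bool (h a b c) + of_bool (h a b e) + of_bool (h a c e) + of_bool (h b c e) \<le> (2::nat)"
    and indep: "\<And>S. S \<subseteq> {1..N} \<Longrightarrow> card S = q \<Longrightarrow> \<exists>a\<in>S. \<exists>b\<in>S. \<exists>c\<in>S. a < b \<and> b < c \<and> h a b c"
    and n: "2 ^ (2 * q) \<le> n"
  shows "\<not> EH_arrows 4 5 4 n (2 ^ N)"
proof -
  define R where "R = {e \<in> nsets {..<2 ^ N} 4. red_edge h e}"
  have few: "card (nsets S 4 \<inter> R) \<le> 3" if S: "S \<in> nsets {..<2 ^ N} 5" for S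
  proof -
    have fin: "finite S" "card S = 5" using S by (auto simp: nsets_def)
    then obtain a b c d e where s: "S = {a, b, c, d, e}" "a < b" "b < c" "c < d" "d < e"
      by (rule obtain_increasing_five)
    let ?F = "\<lambda>X. if red_edge h X then {X} else {}"
    have "nsets S 4 \<inter> R \<subseteq> ?F {b, c, d, e} \<union> ?F {a, c, d, e} \<union> ?F {a, b, d, e} \<union> ?F {a, b, c, e} \<union> ?F {a, b, c, d}"
    proof
      fix X assume X: "X \<in> nsets S 4 \<inter> R"
      then have "X \<subseteq> S" "card X = 4" "red_edge h X" by (auto simp: nsets_def R_def)
      moreover have "card (S - X) = 1"
        using \<open>X \<subseteq> S\<close> \<open>card X = 4\<close> fin finite_subset by (subst card_Diff_subset) auto
      then obtain x where "S - X = {x}" by (rule card_1_singletonE)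
      ultimately have "X = S - {x}" "x \<in> S" "red_edge h X" by auto
      moreover have "S - {a} = {b, c, d, e}" "S - {b} = {a, c, d, e}" "S - {c} = {a, b, d, e}"
        "S - {d} = {a, b, c, e}" "S - {e} = {a, b, c, d}" using s by auto
      moreover have "x = a \<or> x = b \<or> x = c \<or> x = d \<or> x = e" using \<open>x \<in> S\<close> s(1) by simp
      ultimately show "X \<in> ?F {b, c, d, e} \<union> ?F {a, c, d, e} \<union> ?F {a, b, d, e} \<union> ?F {a, b, c, e} \<union> ?F {a, b, c, d}"
        by (elim disjE) simp_all
    qed
    then have "card (nsets S 4 \<inter> R)
        \<le> card (?F {b, c, d, e} \<union> ?F {a, c, d, e} \<union> ?F {a, b, d, e} \<union> ?F {a, b, c, e} \<union> ?F {a, b, c, d})"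
      by (rule card_mono[rotated]) simp
    also have "\<dots> \<le> card (?F {b, c, d, e}) + card (?F {a, c, d, e}) + card (?F {a, b, d, e})
        + card (?F {a, b, c, e}) + card (?F {a, b, c, d})"
      by (intro card_Un_le[THEN order_trans] add_mono order_refl)
    also have "\<dots> = of_bool (red4 h b c d e) + of_bool (red4 h a c d e) + of_bool (red4 h a b d e)
        + of_bool (red4 h a b c e) + of_bool (red4 h a b c d)"
    proof -
      have c: "card (?F X) = of_bool (red_edge h X)" for X by simp
      have "red_edge h {b, c, d, e} = red4 h b c d e" "red_edge h {a, c, d, e} = red4 h a c d e"
        "red_edge h {a, b, d, e} = red4 h a b d e" "red_edge h {a, b, c, e} = red4 h a b c e"
        "red_edge h {a, b, c, d} = red4 h a b c d"
        by (rule red_edge_iff; use s in linarith)+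
      then show ?thesis unfolding c by (simp only:)
    qed
    also have "\<dots> \<le> 3" using h s by (intro red4_five) auto
    finally show ?thesis .
  qed
  have indep4: "nsets T 4 \<inter> R \<noteq> {}" if T: "T \<in> nsets {..<2 ^ N} n" for T
  proof -
    have fin: "finite T" "card T = n" "T \<subseteq> {..<2 ^ N}" using T by (auto simp: nsets_def)
    have level: "level u v \<in> {1..N}" if "u \<in> T" "v \<in> T" "u < v" for u v
      using level_pos[of u v] level_bound[of u N v] fin that by (auto simp: Suc_le_eq)
    have found: "nsets T 4 \<inter> R \<noteq> {}"
      if "v1 \<in> T" "v2 \<in> T" "v3 \<in> T" "v4 \<in> T" "v1 < v2" "v2 < v3" "v3 < v4" "red4 h v1 v2 v3 v4" for v1 v2 v3 v4
    proof -
      let ?e = "{v1, v2, v3, v4}"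
      have "v1 \<notin> {v2, v3, v4}" "v2 \<notin> {v3, v4}" "v3 \<notin> {v4}" using that(5-7) by auto
      then have "card ?e = 4" by simp
      moreover have sub: "?e \<subseteq> T" using that(1-4) by blast
      moreover have "?e \<subseteq> {..<2 ^ N}" using sub fin(3) by (rule subset_trans)
      moreover have "red_edge h ?e" using that(5-8) by (simp only: red_edge_iff)
      ultimately have "?e \<in> nsets T 4 \<inter> R" using finite_subset[OF sub fin(1)]
        unfolding nsets_def R_def by blast
      then show ?thesis by blast
    qed
    have "2 ^ (q + q) \<le> card T" using n fin by (simp add: mult_2)
    note comb_exists[OF fin(1) this]
    then consider S f w where "finite S" "card S = q" "dec_comb T S f w"
      | S f w where "finite S" "card S = q" "inc_comb T S f w"
      by (elim disjE exE conjE)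
    then show ?thesis
    proof cases
      case 1
      have "S \<subseteq> {1..N}"
      proof
        fix a assume "a \<in> S"
        then have "f a \<in> T" "w \<in> T" "f a < w" "level (f a) w = a" using 1 by (auto simp: dec_comb_def)
        then show "a \<in> {1..N}" using level by metis
      qed
      then obtain a b c where abc: "a \<in> S" "b \<in> S" "c \<in> S" "a < b" "b < c" "h a b c"
        using indep 1 by blast
      show ?thesis
        by (rule found[of "f c" "f b" "f a" w])
          (use 1(3) abc in \<open>auto simp: dec_comb_def red4_def Let_def\<close>)
    next
      case 2
      have "S \<subseteq> {1..N}"
      proof
        fix a assume "a \<in> S"
        then have "f a \<in> T" "w \<in> T" "w < f a" "level w (f a) = a" using 2 by (auto simp: inc_comb_def)
        then show "a \<in> {1..N}" using level by metis
      qed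
      then obtain a b c where abc: "a \<in> S" "b \<in> S" "c \<in> S" "a < b" "b < c" "h a b c"
        using indep 2 by blast
      show ?thesis
        by (rule found[of w "f a" "f b" "f c"])
          (use 2(3) abc in \<open>auto simp: inc_comb_def red4_def Let_def\<close>)
    qed
  qed
  have "R \<subseteq> nsets {..<2 ^ N} 4" by (auto simp: R_def)
  moreover have "\<not> (\<exists>S \<in> nsets {..<2 ^ N} 5. card (nsets S 4 \<inter> R) \<ge> 4)" using few by fastforce
  moreover have "\<not> (\<exists>T \<in> nsets {..<2 ^ N} n. nsets T 4 \<inter> R = {})" using indep4 by blast
  ultimately show ?thesis unfolding EH_arrows_def by blast
qed

section \<open>The lower bound\<close>

lemma EH_arrows_mono:
  assumes "EH_arrows k s t n N" "N \<le> N'"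
  shows "EH_arrows k s t n N'"
  unfolding EH_arrows_def
proof (intro allI impI)
  fix R assume "R \<subseteq> nsets {..<N'} k"
  have sub: "nsets {..<N} i \<subseteq> nsets {..<N'} i" for i
    by (rule nsets_mono) (use assms(2) in auto)
  have restr: "nsets S k \<inter> (R \<inter> nsets {..<N} k) = nsets S k \<inter> R" if "S \<in> nsets {..<N} i" for S i
    using that by (auto simp: nsets_def)
  have "R \<inter> nsets {..<N} k \<subseteq> nsets {..<N} k" by auto
  then have "(\<exists>S \<in> nsets {..<N} s. card (nsets S k \<inter> (R \<inter> nsets {..<N} k)) \<ge> t) \<or>
        (\<exists>T \<in> nsets {..<N} n. nsets T k \<inter> (R \<inter> nsets {..<N} k) = {})"
    using assms(1) unfolding EH_arrows_def by blast
  then show "(\<exists>S \<in> nsets {..<N'} s. card (nsets S k \<inter> R) \<ge> t) \<or> (\<exists>T \<in> nsets {..<N'} n. nsets T k \<inter> R = {})"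
  proof
    assume "\<exists>S \<in> nsets {..<N} s. card (nsets S k \<inter> (R \<inter> nsets {..<N} k)) \<ge> t"
    then show ?thesis using restr sub by (metis subsetD)
  next
    assume "\<exists>T \<in> nsets {..<N} n. nsets T k \<inter> (R \<inter> nsets {..<N} k) = {}"
    then show ?thesis using restr sub by (metis subsetD)
  qed
qed

lemma less_EH_number:
  assumes "t \<le> s choose k" "\<not> EH_arrows k s t n N"
  shows "N < EH_number k s t n"
proof (rule ccontr)
  assume "\<not> ?thesis"
  moreover have "EH_arrows k s t n (EH_number k s t n)"
    unfolding EH_number_def by (rule LeastI_ex[OF ex_EH_arrows[OF assms(1)]])
  ultimately show False using assms(2) EH_arrows_mono by (metis not_less)
qed

lemma EH_number_lower_bound:
  assumes "j \<ge> 32" "2 ^ (768 * 2 ^ (168 * j)) \<le> n"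
  shows "2 ^ 2 ^ (j * 2 ^ (168 * j - 1)) < EH_number 4 5 4 n"
proof (rule less_EH_number)
  show "4 \<le> (5::nat) choose 4" by (simp add: numeral_eq_Suc)
  have D2: "(2 ^ (84 * j))\<^sup>2 = (2::nat) ^ (168 * j)" by (simp flip: power_mult)
  obtain h :: "nat \<Rightarrow> nat \<Rightarrow> nat \<Rightarrow> bool"
    where h: "\<forall>a b c e. of_bool (h a b c) + of_bool (h a b e) + of_bool (h a c e) + of_bool (h b c e) \<le> (2::nat)"
      and indep: "\<forall>S \<subseteq> {1..2 ^ (j * 2 ^ (168 * j - 1))}. card S = 384 * 2 ^ (168 * j) \<longrightarrow>
       (\<exists>a\<in>S. \<exists>b\<in>S. \<exists>c\<in>S. a < b \<and> b < c \<and> h a b c)"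
    using sparse_hypergraph_small_independence[OF assms(1)] unfolding D2 by blast
  show "\<not> EH_arrows 4 5 4 n (2 ^ 2 ^ (j * 2 ^ (168 * j - 1)))"
  proof (rule stepping_up[of h])
    (* 384 * 2 ^ (168 j) = 384 D^2 is the size of the sets that contain an edge of h. *)
    show "2 ^ (2 * (384 * 2 ^ (168 * j))) \<le> n" using assms(2) by simp
  qed (use h indep in blast)+
qed

text \<open>
  Let \<open>j\<close> be maximal with \<open>2 ^ (768 * 2 ^ (168 j)) \<le> n\<close>. Then \<open>log n\<close> is at most a constant
  times \<open>2 ^ (168 j)\<close> and \<open>log log n\<close> at most a constant times \<open>j\<close>, whereas the bound for this \<open>j\<close> has
  the exponent \<open>j * 2 ^ (168 j - 1)\<close>.
\<close>
theorem theorem3p4: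
  shows "\<exists>c::real. c > 0 \<and>
    (\<forall>\<^sub>F n in sequentially.
       real (EH_number 4 5 4 n) \<ge> 2 powr (real n powr (c * log 2 (log 2 (real n)))))"
proof -
  (* The factors of K bound log n by 768 * 2 ^ 168 * 2 ^ (168 j) and log log n by 346 j. The factor 2 in c
     makes up for the 1 in the exponent 168 j - 1. *)
  define K where "K = (768 * 346 * 2 ^ 168 :: real)"
  define c where "c = 1 / (2 * K)"
  have K: "K > 0" by (simp add: K_def)
  have "real (EH_number 4 5 4 n) \<ge> 2 powr (real n powr (c * log 2 (log 2 (real n))))"
    if n: "n \<ge> 2 ^ (768 * 2 ^ (168 * 32))" for n :: nat
  proof -
    define P where "P j \<longleftrightarrow> 2 ^ (768 * 2 ^ (168 * j)) \<le> n" for j :: nat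
    define j where "j = (GREATEST j. P j)"
    have bound: "i \<le> n" if "P i" for i
    proof -
      have "i \<le> 768 * 2 ^ (168 * i)"
      proof -
        have "i < 2 ^ i" by (rule less_exp)
        also have "(2::nat) ^ i \<le> 2 ^ (168 * i)" by (rule power_increasing) auto
        finally show ?thesis by simp
      qed
      also have "\<dots> < 2 ^ (768 * 2 ^ (168 * i))" by (rule less_exp)
      also have "\<dots> \<le> n" using that by (simp add: P_def)
      finally show ?thesis by simp
    qed
    have P32: "P 32" using n by (simp only: P_def)
    have Pj: "P j" unfolding j_def using P32 bound by (rule GreatestI_nat)
    have j32: "32 \<le> j" unfolding j_def using P32 bound by (rule Greatest_le_nat)
    have nPj: "\<not> P (Suc j)"
    proof
      assume "P (Suc j)"
      then have "Suc j \<le> j" unfolding j_def using bound by (rule Greatest_le_nat)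
      then show False by simp
    qed
    define x where "x = log 2 (real n)"
    have n2: "2 \<le> n"
    proof -
      have "(2::nat) ^ 1 \<le> 2 ^ (768 * 2 ^ (168 * j))" by (rule power_increasing) auto
      also have "\<dots> \<le> n" using Pj by (simp only: P_def)
      finally show ?thesis by simp
    qed
    have x1: "1 \<le> x" using n2 by (simp add: x_def le_log_iff)
    have x_le: "x \<le> 768 * 2 ^ 168 * 2 ^ (168 * j)"
    proof -
      have "real n < real (2 ^ (768 * 2 ^ (168 * Suc j)))"
        using nPj by (simp only: P_def of_nat_less_iff not_le)
      then have "real n < 2 ^ (768 * 2 ^ (168 * Suc j))" by (simp only: of_nat_power of_nat_numeral)
      then have "x \<le> log 2 (2 ^ (768 * 2 ^ (168 * Suc j)))"
        unfolding x_def using n2 by (subst log_le_cancel_iff) auto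
      also have "\<dots> = real (768 * 2 ^ (168 * Suc j))"
        by (rule log_pow_cancel) auto
      also have "\<dots> = 768 * 2 ^ 168 * 2 ^ (168 * j)"
        by (simp only: of_nat_mult of_nat_power of_nat_numeral mult_Suc_right power_add mult.assoc)
      finally show ?thesis .
    qed
    have log_x: "log 2 x \<le> 346 * real j"
    proof -
      have "x \<le> 2 ^ 10 * 2 ^ 168 * 2 ^ (168 * j)"
        by (rule order_trans[OF x_le], intro mult_right_mono) simp_all
      also have "\<dots> = 2 ^ (178 + 168 * j)" by (simp only: power_add[symmetric]) simp
      finally have "log 2 x \<le> log 2 (2 ^ (178 + 168 * j))"
        using x1 by (subst log_le_cancel_iff) auto
      also have "\<dots> = real (178 + 168 * j)" by (rule log_pow_cancel) auto
      also have "\<dots> \<le> 346 * real j" using j32 by simp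
      finally show ?thesis .
    qed
    define E where "E = j * 2 ^ (168 * j - 1)"
    have "x * log 2 x \<le> (768 * 2 ^ 168 * 2 ^ (168 * j)) * (346 * real j)"
      by (rule mult_mono[OF x_le log_x]) (use x1 in auto)
    also have "\<dots> = K * (real j * 2 ^ (168 * j))" by (simp only: K_def mult_ac)
    also have "(2::real) ^ (168 * j) = 2 * 2 ^ (168 * j - 1)"
      using j32 by (simp flip: power_Suc)
    also have "K * (real j * (2 * 2 ^ (168 * j - 1))) = 2 * K * real E" by (simp add: E_def)
    finally have exp_le: "c * (x * log 2 x) \<le> real E"
      using K by (simp add: c_def field_simps)
    have "real n powr (c * log 2 x) = 2 powr (c * (x * log 2 x))"
    proof -
      have "real n = 2 powr x" using n2 by (simp add: x_def)
      then show ?thesis by (simp add: powr_powr mult_ac)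
    qed
    also have "\<dots> \<le> 2 powr real E" using exp_le by simp
    also have "\<dots> = real (2 ^ E)" by (simp add: powr_realpow)
    finally have "2 powr (real n powr (c * log 2 x)) \<le> 2 powr real (2 ^ E)" by simp
    also have "\<dots> = real (2 ^ 2 ^ E)"
      using powr_realpow[of 2 "2 ^ E", OF zero_less_numeral] by (simp only: of_nat_power of_nat_numeral)
    also have "\<dots> \<le> real (EH_number 4 5 4 n)"
      using EH_number_lower_bound[OF j32 Pj[unfolded P_def]] unfolding E_def
      by (intro of_nat_mono less_imp_le)
    finally show ?thesis by (simp add: x_def)
  qed
  then have "\<forall>\<^sub>F n in sequentially. real (EH_number 4 5 4 n) \<ge> 2 powr (real n powr (c * log 2 (log 2 (real n))))"
    unfolding eventually_sequentially by blast
  moreover have "c > 0" using K by (simp add: c_def)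
  ultimately show ?thesis by blast
qed

end
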